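(* The differential operator \[T=(1-x^2)^2\frac{d^2}{dx^2}+(1-x^2)[\beta-\alpha-(\alpha+\beta+4)x]\frac{d}{dx}+\tfrac14[\kappa^2-(\alpha+\beta+3)^2](1-x^2)\] acts as a five-diagonal operator on the basis $\{\phi_n\}_{n\in\mathbb N}$ of $\mathcal H$ by \[ T \phi_n = a_n \phi_{n+2} + b_n\phi_{n+1} +c_n \phi_n + b_{n-1} \phi_{n-1} + a_{n-2} \phi_{n-2}, \] with coefficients given by \[ a_n = K \alpha_n \gamma_{n+2} (\Lambda_n +\rho), \qquad b_n=K \alpha_n \beta_{n+1}(\Lambda_n+\rho)+ K \beta_n \gamma_{n+1} (\Lambda_{n-1}+\rho), \] \[ c_n= K \alpha_n^2 (\Lambda_n+\rho) + K \beta_n^2(\Lambda_{n-1}+\rho) + K \gamma_n^2 (\Lambda_{n-2}+\rho), \] where $\Lambda_n=-n(n+\alpha+\beta+3)$ and $K,\rho,\alpha_n,\beta_n,\gamma_n$ are given in the context.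
   Context: Notation: $\mathbb N=\{0,1,2,\dots\}$; $(a_1,\dots,a_n)_k=(a_1)_k\cdots(a_n)_k$ (shifted factorials). Real $\alpha,\beta>-1$ with $\beta\ge\alpha$, and $\kappa\in\mathbb R_{\ge 0}\cup i\mathbb R_{>0}$ are fixed. $\mathcal H=L^2((-1,1),w^{(\alpha,\beta)}(x)dx)$, $w^{(\alpha,\beta)}(x)=2^{-\alpha-\beta-1}\frac{\Gamma(\alpha+\beta+2)}{\Gamma(\alpha+1)\Gamma(\beta+1)}(1-x)^\alpha(1+x)^\beta$. $\phi_n=P_n^{(\alpha,\beta)}/(h_n^{(\alpha,\beta)})^{1/2}$, with $P_n^{(\alpha,\beta)}(x)=\frac{(\alpha+1)_n}{n!}{}_2F_1(-n,n+\alpha+\beta+1;\alpha+1;\frac{1-x}2)$ and $h_n^{(\alpha,\beta)}=\frac{\alpha+\beta+1}{2n+\alpha+\beta+1}\frac{(\alpha+1,\beta+1)_n}{(\alpha+\beta+1)_n\,n!}$; $\{\phi_n\}$ is an orthonormal basis of $\mathcal H$. $K=\frac{4(\alpha+1)(\beta+1)}{(\alpha+\beta+2)(\alpha+\beta+3)}$, $\rho=\frac14(\kappa^2-(\alpha+\beta+3)^2)$, and \[\alpha_n=\frac2{\sqrt K}\frac1{2n+\alpha+\beta+2}\sqrt{\frac{(\alpha+n+1)(\beta+n+1)(n+\alpha+\beta+1)(n+\alpha+\beta+2)}{(\alpha+\beta+2n+1)(\alpha+\beta+2n+3)}},\] \[\beta_n=(-1)^n\frac2{\sqrt K}\frac{(\beta-\alpha)\sqrt{n(n+\alpha+\beta+1)}}{(\alpha+\beta+2n)(\alpha+\beta+2n+2)},\qquad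 \gamma_n=-\frac2{\sqrt K}\frac1{2n+\alpha+\beta}\sqrt{\frac{n(n-1)(\alpha+n)(\beta+n)}{(\alpha+\beta+2n-1)(\alpha+\beta+2n+1)}}.\] One has $a_{-1}=a_{-2}=b_{-1}=0$, so terms with negative index are absent.
   Formalization: The factor (-1)^n in β_n is replaced by the constant sign -1: as printed the formula fails, e.g. α=0, β=1, κ=0, where b_1 is 32√6/105, not -272√6/525. At α+β=-1, h_n and α_0 are read by cancelling the removable 0/0. *)

theory Defs
  imports "HOL-Analysis.Analysis"
begin

text \<open>
  Throughout, \<open>\<alpha>, \<beta> > -1\<close>. Hilbert space elements are complex-valued functions on the real line,
  of which only the restriction to the open interval \<open>(-1,1)\<close> matters.
\<close>

definition jacobi_weight :: "real \<Rightarrow> real \<Rightarrow> real \<Rightarrow> real" where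
  "jacobi_weight \<alpha> \<beta> x =
     2 powr (- \<alpha> - \<beta> - 1) * (Gamma (\<alpha> + \<beta> + 2) / (Gamma (\<alpha> + 1) * Gamma (\<beta> + 1)))
       * (1 - x) powr \<alpha> * (1 + x) powr \<beta>"

definition jacobi_measure :: "real \<Rightarrow> real \<Rightarrow> real measure" where
  "jacobi_measure \<alpha> \<beta> =
     density (restrict_space lborel {-1<..<1}) (\<lambda>x. ennreal (jacobi_weight \<alpha> \<beta> x))"

definition L2_space :: "'a measure \<Rightarrow> ('a \<Rightarrow> complex) set" where
  "L2_space M = {f \<in> borel_measurable M. integrable M (\<lambda>x. (cmod (f x))\<^sup>2)}"

definition L2_inner :: "'a measure \<Rightarrow> ('a \<Rightarrow> complex) \<Rightarrow> ('a \<Rightarrow> complex) \<Rightarrow> complex" where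
  "L2_inner M f g = (LINT x|M. f x * cnj (g x))"

text \<open>
  An orthonormal basis is a maximal orthonormal system; elements of \<open>L\<^sup>2\<close> are identified when they
  agree almost everywhere.
\<close>
definition L2_orthonormal_basis :: "'a measure \<Rightarrow> (nat \<Rightarrow> 'a \<Rightarrow> complex) \<Rightarrow> bool" where
  "L2_orthonormal_basis M e \<longleftrightarrow>
     (\<forall>n. e n \<in> L2_space M) \<and>
     (\<forall>m n. L2_inner M (e m) (e n) = (if m = n then 1 else 0)) \<and>
     (\<forall>f\<in>L2_space M. (\<forall>n. L2_inner M f (e n) = 0) \<longrightarrow> (AE x in M. f x = 0))"

definition hyp2F1 :: "real \<Rightarrow> real \<Rightarrow> real \<Rightarrow> real \<Rightarrow> real" where
  "hyp2F1 a b c z =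
     (\<Sum>k. pochhammer a k * pochhammer b k / (pochhammer c k * fact k) * z ^ k)"

definition jacobi_P :: "real \<Rightarrow> real \<Rightarrow> nat \<Rightarrow> real \<Rightarrow> real" where
  "jacobi_P \<alpha> \<beta> n x =
     pochhammer (\<alpha> + 1) n / fact n
       * hyp2F1 (- real n) (real n + \<alpha> + \<beta> + 1) (\<alpha> + 1) ((1 - x) / 2)"

text \<open>
  The usual formulas for \<open>h\<^sub>n\<close> and \<open>\<alpha>\<^sub>n\<close> (see \<open>jacobi_h_eq\<close> and \<open>jacobi_alpha_eq\<close> below) have a
  removable singularity at \<open>\<alpha> + \<beta> = -1\<close>, for all \<open>n\<close> and for \<open>n = 0\<close> respectively, where division
  by zero would yield the wrong value. Both are therefore written in terms of the quotient
  \<open>(n + \<alpha> + \<beta> + 1) / (2 n + \<alpha> + \<beta> + 1)\<close>, continued by \<open>1\<close> for \<open>n = 0\<close>.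
\<close>
definition jacobi_quot :: "real \<Rightarrow> real \<Rightarrow> nat \<Rightarrow> real" where
  "jacobi_quot \<alpha> \<beta> n =
     (if n = 0 then 1 else (real n + \<alpha> + \<beta> + 1) / (2 * real n + \<alpha> + \<beta> + 1))"

definition jacobi_h :: "real \<Rightarrow> real \<Rightarrow> nat \<Rightarrow> real" where
  "jacobi_h \<alpha> \<beta> n =
     jacobi_quot \<alpha> \<beta> n
       * (pochhammer (\<alpha> + 1) n * pochhammer (\<beta> + 1) n / (pochhammer (\<alpha> + \<beta> + 2) n * fact n))"

definition jacobi_phi :: "real \<Rightarrow> real \<Rightarrow> nat \<Rightarrow> real \<Rightarrow> complex" where
  "jacobi_phi \<alpha> \<beta> n x = complex_of_real (jacobi_P \<alpha> \<beta> n x / sqrt (jacobi_h \<alpha> \<beta> n))"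

definition jacobi_K :: "real \<Rightarrow> real \<Rightarrow> real" where
  "jacobi_K \<alpha> \<beta> = 4 * (\<alpha> + 1) * (\<beta> + 1) / ((\<alpha> + \<beta> + 2) * (\<alpha> + \<beta> + 3))"

definition jacobi_rho :: "real \<Rightarrow> real \<Rightarrow> complex \<Rightarrow> complex" where
  "jacobi_rho \<alpha> \<beta> \<kappa> = (\<kappa>\<^sup>2 - (complex_of_real (\<alpha> + \<beta> + 3))\<^sup>2) / 4"

definition jacobi_alpha :: "real \<Rightarrow> real \<Rightarrow> nat \<Rightarrow> real" where
  "jacobi_alpha \<alpha> \<beta> n =
     2 / sqrt (jacobi_K \<alpha> \<beta>) * (1 / (2 * real n + \<alpha> + \<beta> + 2))
       * sqrt (jacobi_quot \<alpha> \<beta> n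
                * ((\<alpha> + real n + 1) * (\<beta> + real n + 1) * (real n + \<alpha> + \<beta> + 2)
                    / (\<alpha> + \<beta> + 2 * real n + 3)))"

text \<open>
  The sign of \<open>\<beta>\<^sub>n\<close> does not alternate: with a factor \<open>(-1)\<^sup>n\<close> in place of the minus sign, which
  occurs in print, the formula for \<open>b\<^sub>n\<close> below is wrong in general if \<open>\<alpha> \<noteq> \<beta>\<close>. For \<open>\<alpha> = 0\<close>, \<open>\<beta> = 1\<close>,
  \<open>\<kappa> = 0\<close>, for instance, the coefficient \<open>b\<^sub>1\<close> must be \<open>32 \<surd>6 / 105\<close>, whereas the alternating sign
  yields \<open>- 272 \<surd>6 / 525\<close>.

  The values \<open>\<beta>\<^sub>0 = \<gamma>\<^sub>0 = \<gamma>\<^sub>1 = 0\<close> are correct also if a denominator vanishes there.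
\<close>
definition jacobi_beta :: "real \<Rightarrow> real \<Rightarrow> nat \<Rightarrow> real" where
  "jacobi_beta \<alpha> \<beta> n =
     - (2 / sqrt (jacobi_K \<alpha> \<beta>))
       * ((\<beta> - \<alpha>) * sqrt (real n * (real n + \<alpha> + \<beta> + 1))
           / ((\<alpha> + \<beta> + 2 * real n) * (\<alpha> + \<beta> + 2 * real n + 2)))"

definition jacobi_gamma :: "real \<Rightarrow> real \<Rightarrow> nat \<Rightarrow> real" where
  "jacobi_gamma \<alpha> \<beta> n =
     - (2 / sqrt (jacobi_K \<alpha> \<beta>)) * (1 / (2 * real n + \<alpha> + \<beta>))
       * sqrt (real n * (real n - 1) * (\<alpha> + real n) * (\<beta> + real n)
                / ((\<alpha> + \<beta> + 2 * real n - 1) * (\<alpha> + \<beta> + 2 * real n + 1)))"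

text \<open>The index is an integer because \<open>\<Lambda>\<close> is used at \<open>-1\<close> and \<open>-2\<close> as well.\<close>
definition jacobi_Lambda :: "real \<Rightarrow> real \<Rightarrow> int \<Rightarrow> real" where
  "jacobi_Lambda \<alpha> \<beta> n = - real_of_int n * (real_of_int n + \<alpha> + \<beta> + 3)"

definition coeff_a :: "real \<Rightarrow> real \<Rightarrow> complex \<Rightarrow> nat \<Rightarrow> complex" where
  "coeff_a \<alpha> \<beta> \<kappa> n =
     of_real (jacobi_K \<alpha> \<beta> * jacobi_alpha \<alpha> \<beta> n * jacobi_gamma \<alpha> \<beta> (n + 2))
       * (of_real (jacobi_Lambda \<alpha> \<beta> (int n)) + jacobi_rho \<alpha> \<beta> \<kappa>)"

definition coeff_b :: "real \<Rightarrow> real \<Rightarrow> complex \<Rightarrow> nat \<Rightarrow> complex" where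
  "coeff_b \<alpha> \<beta> \<kappa> n =
     of_real (jacobi_K \<alpha> \<beta> * jacobi_alpha \<alpha> \<beta> n * jacobi_beta \<alpha> \<beta> (n + 1))
       * (of_real (jacobi_Lambda \<alpha> \<beta> (int n)) + jacobi_rho \<alpha> \<beta> \<kappa>)
     + of_real (jacobi_K \<alpha> \<beta> * jacobi_beta \<alpha> \<beta> n * jacobi_gamma \<alpha> \<beta> (n + 1))
       * (of_real (jacobi_Lambda \<alpha> \<beta> (int n - 1)) + jacobi_rho \<alpha> \<beta> \<kappa>)"

definition coeff_c :: "real \<Rightarrow> real \<Rightarrow> complex \<Rightarrow> nat \<Rightarrow> complex" where
  "coeff_c \<alpha> \<beta> \<kappa> n =
     of_real (jacobi_K \<alpha> \<beta> * (jacobi_alpha \<alpha> \<beta> n)\<^sup>2)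
       * (of_real (jacobi_Lambda \<alpha> \<beta> (int n)) + jacobi_rho \<alpha> \<beta> \<kappa>)
     + of_real (jacobi_K \<alpha> \<beta> * (jacobi_beta \<alpha> \<beta> n)\<^sup>2)
       * (of_real (jacobi_Lambda \<alpha> \<beta> (int n - 1)) + jacobi_rho \<alpha> \<beta> \<kappa>)
     + of_real (jacobi_K \<alpha> \<beta> * (jacobi_gamma \<alpha> \<beta> n)\<^sup>2)
       * (of_real (jacobi_Lambda \<alpha> \<beta> (int n - 2)) + jacobi_rho \<alpha> \<beta> \<kappa>)"

definition jacobi_T :: "real \<Rightarrow> real \<Rightarrow> complex \<Rightarrow> (real \<Rightarrow> complex) \<Rightarrow> real \<Rightarrow> complex" where
  "jacobi_T \<alpha> \<beta> \<kappa> f x =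
     of_real ((1 - x\<^sup>2)\<^sup>2) * vector_derivative (\<lambda>y. vector_derivative f (at y)) (at x)
     + of_real ((1 - x\<^sup>2) * (\<beta> - \<alpha> - (\<alpha> + \<beta> + 4) * x)) * vector_derivative f (at x)
     + 1 / 4 * (\<kappa>\<^sup>2 - (of_real (\<alpha> + \<beta> + 3))\<^sup>2) * of_real (1 - x\<^sup>2) * f x"

lemma jacobi_h_eq:
  assumes "\<alpha> > -1" "\<beta> > -1" "\<alpha> + \<beta> \<noteq> -1"
  shows "jacobi_h \<alpha> \<beta> n =
           (\<alpha> + \<beta> + 1) / (2 * real n + \<alpha> + \<beta> + 1)
             * (pochhammer (\<alpha> + 1) n * pochhammer (\<beta> + 1) n
                 / (pochhammer (\<alpha> + \<beta> + 1) n * fact n))"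
proof (cases "n = 0")
  case True
  then show ?thesis using assms by (simp add: jacobi_h_def jacobi_quot_def)
next
  case False
  let ?a = "\<alpha> + \<beta> + 1"
  have 1: "?a * pochhammer (?a + 1) n = pochhammer ?a n * (?a + real n)"
    by (metis pochhammer_rec pochhammer_Suc)
  have 2: "pochhammer (?a + 1) n > 0"
    using assms by (intro pochhammer_pos) simp
  have 3: "real n \<ge> 1" using False by simp
  have 4: "?a + real n > 0" using assms 3 by linarith
  have 5: "?a \<noteq> 0" using assms by simp
  have 6: "pochhammer ?a n \<noteq> 0" using 1 2 5 by auto
  have "(real n + \<alpha> + \<beta> + 1) / pochhammer (\<alpha> + \<beta> + 2) n = ?a / pochhammer ?a n"
    using 1 2 6 by (simp add: field_simps)
  then have "(real n + \<alpha> + \<beta> + 1) / pochhammer (\<alpha> + \<beta> + 2) n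
               * (pochhammer (\<alpha> + 1) n * pochhammer (\<beta> + 1) n
                   / ((2 * real n + \<alpha> + \<beta> + 1) * fact n)) =
             ?a / pochhammer ?a n
               * (pochhammer (\<alpha> + 1) n * pochhammer (\<beta> + 1) n
                   / ((2 * real n + \<alpha> + \<beta> + 1) * fact n))"
    by (rule arg_cong)
  then show ?thesis using False
    by (simp add: jacobi_h_def jacobi_quot_def mult_ac)
qed

lemma jacobi_alpha_eq:
  assumes "\<alpha> + \<beta> \<noteq> -1"
  shows "jacobi_alpha \<alpha> \<beta> n =
     2 / sqrt (jacobi_K \<alpha> \<beta>) * (1 / (2 * real n + \<alpha> + \<beta> + 2))
       * sqrt ((\<alpha> + real n + 1) * (\<beta> + real n + 1) * (real n + \<alpha> + \<beta> + 1) * (real n + \<alpha> + \<beta> + 2)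
                / ((\<alpha> + \<beta> + 2 * real n + 1) * (\<alpha> + \<beta> + 2 * real n + 3)))"
proof -
  have "jacobi_quot \<alpha> \<beta> n = (real n + \<alpha> + \<beta> + 1) / (\<alpha> + \<beta> + 2 * real n + 1)"
    using assms by (simp add: jacobi_quot_def add_ac)
  then show ?thesis by (simp add: jacobi_alpha_def mult_ac)
qed

end

theory Submission
  imports Defs
begin

text \<open>
  Throughout, \<open>y = (1 - x) / 2\<close> and Jacobi polynomials are treated as polynomials in \<open>y\<close>. On these
  the measure acts through its moments \<open>(\<alpha>+1)\<^sub>k / (\<alpha>+\<beta>+2)\<^sub>k\<close>, which make the Jacobi differential
  operator symmetric on monomials; distinct eigenvalues give orthogonality, and the norms follow by
  recursion from two contiguous relations. Completeness is Weierstrass approximation.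

  For the five-diagonal formula, \<open>T = (1 - x\<^sup>2) (D + \<rho>)\<close> where \<open>D\<close> is the Jacobi operator with
  parameters \<open>(\<alpha>+1, \<beta>+1)\<close>, whose normalised eigenfunctions \<open>\<Phi>\<^sub>n\<close> have eigenvalues \<open>\<Lambda>\<^sub>n\<close>. One expands
  \<open>\<phi>\<^sub>n = \<alpha>\<^sub>n \<Phi>\<^sub>n + \<beta>\<^sub>n \<Phi>\<^bsub>n-1\<^esub> + \<gamma>\<^sub>n \<Phi>\<^bsub>n-2\<^esub>\<close>, applies \<open>D + \<rho>\<close>, and returns by the adjoint relation
  \<open>(1 - x\<^sup>2) \<Phi>\<^sub>n = K (\<alpha>\<^sub>n \<phi>\<^sub>n + \<beta>\<^bsub>n+1\<^esub> \<phi>\<^bsub>n+1\<^esub> + \<gamma>\<^bsub>n+2\<^esub> \<phi>\<^bsub>n+2\<^esub>)\<close>.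
\<close>

section \<open>Jacobi polynomials and contiguous relations\<close>

text \<open>The coefficient of \<open>y^k\<close>. It is defined for every \<open>k\<close> and is
  zero beyond \<open>n\<close>, so polynomial identities can be checked coefficient by coefficient
  without tracking degrees.\<close>

definition jacobi_c :: "real \<Rightarrow> real \<Rightarrow> nat \<Rightarrow> nat \<Rightarrow> real" where
  "jacobi_c a b n k = pochhammer (a + 1) n / fact n
     * (pochhammer (- real n) k * pochhammer (real n + a + b + 1) k / (pochhammer (a + 1) k * fact k))"

lemma jacobi_c_eq_0: "n < k \<Longrightarrow> jacobi_c a b n k = 0"
  by (auto simp: jacobi_c_def pochhammer_of_nat_eq_0_iff)

text \<open>Both sides equal \<open>pochhammer z (Suc n)\<close>, with the first or the last factor
  split off.\<close>

lemma pochhammer_shift: "(z :: real) * pochhammer (z + 1) n = pochhammer z n * (z + real n)"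
  by (metis pochhammer_rec pochhammer_Suc)

text \<open>The ratio of consecutive terms of the hypergeometric series. Cleared of denominators, it
  stays true at \<open>k = n\<close>, where the series stops.\<close>

lemma jacobi_c_Suc:
  assumes "a > -1"
  shows "(a + 1 + real k) * (real k + 1) * jacobi_c a b n (Suc k) =
    (real k - real n) * (real n + a + b + 1 + real k) * jacobi_c a b n k"
proof -
  have "pochhammer (a + 1) k > 0" "a + 1 + real k > 0"
    using assms by (auto intro!: pochhammer_pos)
  then show ?thesis
    by (simp add: jacobi_c_def pochhammer_Suc divide_simps)
qed

text \<open>Three Pochhammer symbols contain \<open>a\<close>, and each changes by one
  \<open>pochhammer_shift\<close>. The factor \<open>n + a + b + 1\<close> is not divided out
  because it can vanish, for instance at \<open>n = 0\<close>, \<open>a + b = -1\<close>.\<close>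

lemma jacobi_c_raise_a:
  assumes "a > -1"
  shows "(real n + a + b + 1) * (a + 1 + real k) * jacobi_c (a + 1) b n k =
    (a + 1 + real n) * (real n + a + b + 1 + real k) * jacobi_c a b n k"
proof -
  have pos: "pochhammer (a + 1) k > 0" "pochhammer (a + 2) k > 0" "a + 1 > 0"
    using assms by (auto intro!: pochhammer_pos)
  have n: "pochhammer (a + 2) n = pochhammer (a + 1) n * (a + 1 + real n) / (a + 1)" for n
    using pochhammer_shift[of "a + 1" n] pos by (simp add: field_simps)
  have s: "(real n + a + b + 1) * pochhammer (real n + a + b + 2) k =
      (real n + a + b + 1 + real k) * pochhammer (real n + a + b + 1) k"
    using pochhammer_shift[of "real n + a + b + 1" k] by (simp add: algebra_simps)
  have "(real n + a + b + 1) * (a + 1 + real k) * jacobi_c (a + 1) b n k =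
    (a + 1 + real k) * (pochhammer (a + 2) n / fact n) * pochhammer (- real n) k
      / (pochhammer (a + 2) k * fact k) * ((real n + a + b + 1) * pochhammer (real n + a + b + 2) k)"
    by (simp add: jacobi_c_def add_ac)
  also have "\<dots> = (a + 1 + real n) * (real n + a + b + 1 + real k) * jacobi_c a b n k"
    unfolding s n using pos assms by (simp add: jacobi_c_def divide_simps add_pos_nonneg)
  finally show ?thesis .
qed

lemma jacobi_c_raise_b:
  "(real n + a + b + 1) * jacobi_c a (b + 1) n k = (real n + a + b + 1 + real k) * jacobi_c a b n k"
proof -
  have s: "(real n + a + b + 1) * pochhammer (real n + a + b + 2) k =
      (real n + a + b + 1 + real k) * pochhammer (real n + a + b + 1) k"
    using pochhammer_shift[of "real n + a + b + 1" k] by (simp add: algebra_simps)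
  have "(real n + a + b + 1) * jacobi_c a (b + 1) n k =
    (pochhammer (a + 1) n / fact n) * pochhammer (- real n) k
      / (pochhammer (a + 1) k * fact k) * ((real n + a + b + 1) * pochhammer (real n + a + b + 2) k)"
    by (simp add: jacobi_c_def add_ac)
  then show ?thesis
    unfolding s by (simp add: jacobi_c_def)
qed

lemma pochhammer_minus_Suc:
  "(real n + 1) * pochhammer (- real n) k = (real n + 1 - real k) * pochhammer (- real (Suc n)) k"
  using pochhammer_shift[of "- real (Suc n)" k] by (simp add: algebra_simps)

text \<open>Raising \<open>a\<close> while lowering the degree keeps \<open>n + a + b + 1\<close>
  fixed, so the Pochhammer symbol based on it is the same on both sides. The same holds for
  \<open>b\<close> in \<open>jacobi_c_raise_b_lower_n\<close>.\<close>

lemma jacobi_c_raise_a_lower_n: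
  assumes "a > -1"
  shows "(a + 1 + real k) * jacobi_c (a + 1) b n k = (real n + 1 - real k) * jacobi_c a b (Suc n) k"
proof -
  have pos: "pochhammer (a + 1) k > 0" "pochhammer (a + 2) k > 0" "a + 1 > 0"
    using assms by (auto intro!: pochhammer_pos)
  have k: "pochhammer (a + 2) k = pochhammer (a + 1) k * (a + 1 + real k) / (a + 1)"
    using pochhammer_shift[of "a + 1" k] pos by (simp add: field_simps)
  have n: "pochhammer (a + 2) n = pochhammer (a + 1) (Suc n) / (a + 1)"
    using pos by (simp add: pochhammer_rec add.assoc)
  have m: "pochhammer (- real n) k =
      (real n + 1 - real k) * pochhammer (- real (Suc n)) k / (real n + 1)"
    using pochhammer_minus_Suc[of n k] by (simp add: field_simps)
  have "(a + 1 + real k) * jacobi_c (a + 1) b n k = (a + 1 + real k) *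
    (pochhammer (a + 2) n / fact n) * pochhammer (- real n) k
      / (pochhammer (a + 2) k * fact k) * pochhammer (real (Suc n) + a + b + 1) k"
    by (simp add: jacobi_c_def add_ac)
  also have "\<dots> = (real n + 1 - real k) * jacobi_c a b (Suc n) k"
    unfolding k n m using pos assms
    by (simp add: jacobi_c_def divide_simps add_pos_nonneg del: of_nat_Suc)
  finally show ?thesis .
qed

lemma jacobi_c_raise_b_lower_n:
  "(real n + 1 + a) * jacobi_c a (b + 1) n k = (real n + 1 - real k) * jacobi_c a b (Suc n) k"
proof -
  have m: "pochhammer (- real n) k =
      (real n + 1 - real k) * pochhammer (- real (Suc n)) k / (real n + 1)"
    using pochhammer_minus_Suc[of n k] by (simp add: field_simps)
  have "(real n + 1 + a) * jacobi_c a (b + 1) n k =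
    ((a + 1 + real n) * pochhammer (a + 1) n / fact n) * pochhammer (- real n) k
      / (pochhammer (a + 1) k * fact k) * pochhammer (real (Suc n) + a + b + 1) k"
    by (simp add: jacobi_c_def add_ac)
  also have "\<dots> = (real n + 1 - real k) * jacobi_c a b (Suc n) k"
    unfolding m
    by (simp add: jacobi_c_def pochhammer_Suc divide_simps del: of_nat_Suc)
  finally show ?thesis .
qed

section \<open>Differential equation, connection formulas and multiplication by \<open>y\<close> and
  \<open>1 - y\<close>\<close>

definition jacobi_poly :: "real \<Rightarrow> real \<Rightarrow> nat \<Rightarrow> real poly" where
  "jacobi_poly a b n = (\<Sum>k\<le>n. monom (jacobi_c a b n k) k)"

lemma coeff_jacobi_poly: "coeff (jacobi_poly a b n) k = jacobi_c a b n k"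
  by (auto simp: jacobi_poly_def coeff_sum jacobi_c_eq_0)

lemma jacobi_poly_0: "jacobi_poly a b 0 = 1"
  by (simp add: jacobi_poly_def jacobi_c_def)

lemma poly_jacobi_poly: "poly (jacobi_poly a b n) ((1 - x) / 2) = jacobi_P a b n x"
proof -
  have "hyp2F1 (- real n) (real n + a + b + 1) (a + 1) z =
    (\<Sum>k\<le>n. pochhammer (- real n) k * pochhammer (real n + a + b + 1) k / (pochhammer (a + 1) k * fact k) * z ^ k)" for z
    unfolding hyp2F1_def
    by (rule suminf_finite) (auto simp: pochhammer_of_nat_eq_0_iff)
  then show ?thesis
    by (simp add: jacobi_P_def jacobi_poly_def poly_sum poly_monom jacobi_c_def sum_distrib_left mult_ac)
qed

text \<open>Coefficient by coefficient, the Jacobi equation in \<open>y\<close> is the term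
  recursion \<open>jacobi_c_Suc\<close>.\<close>

lemma jacobi_poly_ode:
  assumes "a > -1"
  shows "[:0, 1, -1:] * pderiv (pderiv (jacobi_poly a b n))
    + [:a + 1, - (a + b + 2):] * pderiv (jacobi_poly a b n)
    = smult (- real n * (real n + a + b + 1)) (jacobi_poly a b n)"
proof (rule poly_eqI)
  fix k
  let ?c = "jacobi_c a b n"
  show "coeff ([:0, 1, -1:] * pderiv (pderiv (jacobi_poly a b n))
    + [:a + 1, - (a + b + 2):] * pderiv (jacobi_poly a b n)) k =
    coeff (smult (- real n * (real n + a + b + 1)) (jacobi_poly a b n)) k"
  proof (cases k)
    case 0
    then show ?thesis using jacobi_c_Suc[OF assms, of 0 b n]
      by (simp add: coeff_pderiv coeff_jacobi_poly coeff_pCons algebra_simps)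
  next
    case (Suc j)
    then show ?thesis using jacobi_c_Suc[OF assms, of k b n]
      by (cases j) (simp_all add: coeff_pderiv coeff_jacobi_poly coeff_pCons algebra_simps)
  qed
qed

text \<open>The raising lemmas turn both coefficients on the right into multiples of
  \<open>jacobi_c a b n k\<close>. What remains is \<open>(a + 1 + n) * (n + a + b + 1 + k) - (n +
  b) * (n - k) = (2 * n + a + b + 1) * (a + 1 + k)\<close>.\<close>

lemma jacobi_poly_connect_a:
  assumes "a > -1"
  shows "smult (2 * real n + a + b + 1) (jacobi_poly a b n) =
    smult (real n + a + b + 1) (jacobi_poly (a + 1) b n)
    - (if n = 0 then 0 else smult (real n + b) (jacobi_poly (a + 1) b (n - 1)))"
proof (rule poly_eqI)
  fix k
  have k: "a + 1 + real k > 0" using assms by linarith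
  have 1: "(real n + a + b + 1) * jacobi_c (a + 1) b n k =
    (a + 1 + real n) * (real n + a + b + 1 + real k) * jacobi_c a b n k / (a + 1 + real k)"
    using jacobi_c_raise_a[OF assms, of n b k] k by (simp add: field_simps)
  show "coeff (smult (2 * real n + a + b + 1) (jacobi_poly a b n)) k =
    coeff (smult (real n + a + b + 1) (jacobi_poly (a + 1) b n)
    - (if n = 0 then 0 else smult (real n + b) (jacobi_poly (a + 1) b (n - 1)))) k"
  proof (cases n)
    case 0
    then show ?thesis by (simp add: jacobi_poly_0)
  next
    case (Suc m)
    have 2: "jacobi_c (a + 1) b m k = (real n - real k) * jacobi_c a b n k / (a + 1 + real k)"
      using jacobi_c_raise_a_lower_n[OF assms, of k b m] k Suc by (simp add: field_simps)
    have "coeff (smult (real n + a + b + 1) (jacobi_poly (a + 1) b n)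
      - (if n = 0 then 0 else smult (real n + b) (jacobi_poly (a + 1) b (n - 1)))) k
      = (real n + a + b + 1) * jacobi_c (a + 1) b n k - (real n + b) * jacobi_c (a + 1) b m k"
      by (simp add: Suc coeff_jacobi_poly)
    also have "\<dots> = (2 * real n + a + b + 1) * jacobi_c a b n k"
      unfolding 1 2 using k by (simp add: divide_simps) algebra
    finally show ?thesis by (simp add: coeff_jacobi_poly)
  qed
qed

lemma jacobi_poly_connect_b:
  "smult (2 * real n + a + b + 1) (jacobi_poly a b n) =
    smult (real n + a + b + 1) (jacobi_poly a (b + 1) n)
    + (if n = 0 then 0 else smult (real n + a) (jacobi_poly a (b + 1) (n - 1)))"
proof (rule poly_eqI)
  fix k
  show "coeff (smult (2 * real n + a + b + 1) (jacobi_poly a b n)) k =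
    coeff (smult (real n + a + b + 1) (jacobi_poly a (b + 1) n)
    + (if n = 0 then 0 else smult (real n + a) (jacobi_poly a (b + 1) (n - 1)))) k"
  proof (cases n)
    case 0
    then show ?thesis by (simp add: jacobi_poly_0)
  next
    case (Suc m)
    then show ?thesis using jacobi_c_raise_b[of n a b k] jacobi_c_raise_b_lower_n[of m a b k]
      by (simp add: coeff_jacobi_poly algebra_simps)
  qed
qed

text \<open>This and the next lemma express coefficients at \<open>k + 1\<close> through
  \<open>jacobi_c a (b + 1) n k\<close>, the common unit in the comparison for multiplication by
  \<open>1 - y\<close>.\<close>

lemma jacobi_c_lower_b_Suc:
  assumes "a > -1"
  shows "(a + 1 + real k) * (real k + 1) * jacobi_c a b n (Suc k) =
    (real k - real n) * (real n + a + b + 1) * jacobi_c a (b + 1) n k"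
  unfolding jacobi_c_Suc[OF assms] using jacobi_c_raise_b[of n a b k] by algebra

lemma jacobi_c_Suc_Suc:
  assumes "a > -1"
  shows "(a + 1 + real k) * (real k + 1) * jacobi_c a b (Suc n) (Suc k) =
    - (real n + a + 1) * (real n + a + b + 2 + real k) * jacobi_c a (b + 1) n k"
proof -
  have "(real k - real (Suc n)) * jacobi_c a b (Suc n) k = - (real n + 1 + a) * jacobi_c a (b + 1) n k"
    using jacobi_c_raise_b_lower_n[of n a b k] by (simp add: algebra_simps)
  then show ?thesis
    unfolding jacobi_c_Suc[OF assms] by simp algebra
qed

text \<open>The way back from \<open>jacobi_poly_connect_a\<close>: a factor \<open>y\<close> lowers
  \<open>a + 1\<close> to \<open>a\<close> again, with two terms, now of degrees \<open>n\<close>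
  and \<open>n + 1\<close>.\<close>

lemma jacobi_poly_times_y:
  assumes "a > -1"
  shows "smult (2 * real n + a + b + 2) ([:0, 1:] * jacobi_poly (a + 1) b n) =
    smult (real n + a + 1) (jacobi_poly a b n) - smult (real n + 1) (jacobi_poly a b (Suc n))"
proof (rule poly_eqI)
  fix k
  show "coeff (smult (2 * real n + a + b + 2) ([:0, 1:] * jacobi_poly (a + 1) b n)) k =
    coeff (smult (real n + a + 1) (jacobi_poly a b n) - smult (real n + 1) (jacobi_poly a b (Suc n))) k"
  proof (cases k)
    case 0
    then show ?thesis
      by (simp add: coeff_jacobi_poly jacobi_c_def pochhammer_Suc divide_simps) (simp_all add: algebra_simps)
  next
    case (Suc j)
    have "a + 1 + real j > 0" using assms by auto
    then have j: "(a + 1 + real j) * (real j + 1) \<noteq> 0" by simp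
    \<comment> \<open>Every term is a multiple of \<open>jacobi_c (a + 1) b n j\<close>; the claim
      becomes \<open>(j - n) * (n + a + b + 1) + (n + 1) * (n + a + b + 2 + j) = (j + 1) * (2 * n +
      a + b + 2)\<close>.\<close>
    have "(a + 1 + real j) * (real j + 1) * ((2 * real n + a + b + 2) * jacobi_c (a + 1) b n j)
      = (a + 1 + real j) * (real j + 1) * ((real n + a + 1) * jacobi_c a b n (Suc j) - (real n + 1) * jacobi_c a b (Suc n) (Suc j))"
      using jacobi_c_Suc[OF assms, of j b n] jacobi_c_raise_a[OF assms, of n b j]
        jacobi_c_Suc[OF assms, of j b "Suc n"] jacobi_c_raise_a_lower_n[OF assms, of j b n]
      unfolding of_nat_Suc by algebra
    then show ?thesis using j by (simp add: Suc coeff_jacobi_poly)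
  qed
qed

lemma jacobi_poly_times_1_minus_y:
  assumes "a > -1"
  shows "smult (2 * real n + a + b + 2) ([:1, -1:] * jacobi_poly a (b + 1) n) =
    smult (real n + b + 1) (jacobi_poly a b n) + smult (real n + 1) (jacobi_poly a b (Suc n))"
proof (rule poly_eqI)
  fix k
  show "coeff (smult (2 * real n + a + b + 2) ([:1, -1:] * jacobi_poly a (b + 1) n)) k =
    coeff (smult (real n + b + 1) (jacobi_poly a b n) + smult (real n + 1) (jacobi_poly a b (Suc n))) k"
  proof (cases k)
    case 0
    then show ?thesis
      by (simp add: coeff_jacobi_poly jacobi_c_def pochhammer_Suc divide_simps) (simp_all add: algebra_simps)
  next
    case (Suc j)
    let ?Y = "jacobi_c a (b + 1) n j"
    have "a + 1 + real j > 0" using assms by auto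
    then have j: "(a + 1 + real j) * (real j + 1) \<noteq> 0" by simp
    have "(a + 1 + real j) * (real j + 1) * ((2 * real n + a + b + 2) * (jacobi_c a (b + 1) n (Suc j) - jacobi_c a (b + 1) n j))
      = (a + 1 + real j) * (real j + 1) * ((real n + b + 1) * jacobi_c a b n (Suc j) + (real n + 1) * jacobi_c a b (Suc n) (Suc j))"
      using jacobi_c_Suc[OF assms, of j "b + 1" n] jacobi_c_lower_b_Suc[OF assms, of j b n] jacobi_c_Suc_Suc[OF assms, of j b n]
      unfolding of_nat_Suc by algebra
    then show ?thesis using j by (simp add: Suc coeff_jacobi_poly)
  qed
qed

section \<open>Orthogonality and norms\<close>

lemma space_jacobi_measure [simp]: "space (jacobi_measure a b) = {-1<..<1}"
  by (simp add: jacobi_measure_def space_restrict_space)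

lemma sets_jacobi_measure [measurable_cong]:
  "sets (jacobi_measure a b) = sets (restrict_space borel {-1<..<1})"
  by (simp add: jacobi_measure_def sets_restrict_space)

lemma borel_measurable_jacobi_measure:
  "f \<in> borel_measurable borel \<Longrightarrow> f \<in> borel_measurable (jacobi_measure a b)"
  by (simp add: measurable_cong_sets[OF sets_jacobi_measure refl] measurable_restrict_space1)

lemma jacobi_weight_measurable: "jacobi_weight a b \<in> borel_measurable borel"
  unfolding jacobi_weight_def by measurable

lemma jacobi_weight_nonneg:
  assumes "a > -1" "b > -1"
  shows "jacobi_weight a b x \<ge> 0"
  unfolding jacobi_weight_def using assms
  by (intro mult_nonneg_nonneg divide_nonneg_nonneg less_imp_le[OF Gamma_real_pos]) auto

text \<open>The substitution \<open>t = (1 - x) / 2\<close> gives the Beta integral with parameters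
  \<open>a + 1 + k\<close> and \<open>b + 1\<close>. Together with the normalising constant, its
  Gamma values collapse to a quotient of Pochhammer symbols.\<close>

lemma has_integral_jacobi_weight_power:
  assumes ab: "a > -1" "b > -1"
  shows "((\<lambda>x. jacobi_weight a b x * ((1 - x) / 2) ^ k) has_integral
    pochhammer (a + 1) k / pochhammer (a + b + 2) k) {-1<..<1}"
proof -
  let ?C = "Gamma (a + b + 2) / (Gamma (a + 1) * Gamma (b + 1))"
  let ?f = "\<lambda>t. t powr (a + real k) * (1 - t) powr b"
  have "(?f has_integral Beta (a + 1 + real k) (b + 1)) (cbox 0 1)"
    using has_integral_Beta_real[of "a + 1 + real k" "b + 1"] ab by simp
  from has_integral_affinity[OF this, of "- 1 / 2" "1 / 2"]
  have "((\<lambda>x. ?f ((1 - x) / 2)) has_integral 2 * Beta (a + 1 + real k) (b + 1))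
      ((\<lambda>x. 1 - 2 * x) ` {0..1})"
    by (simp add: diff_divide_distrib)
  also have "(\<lambda>x. 1 - 2 * x) ` {0..1} = {-1..1::real}"
  proof -
    have "x \<in> (\<lambda>x. 1 - 2 * x) ` {0..1}" if "x \<in> {-1..1}" for x :: real
      using that by (intro image_eqI[of _ _ "(1 - x) / 2"]) (auto simp: field_simps)
    then show ?thesis by auto
  qed
  finally have "((\<lambda>x. ?C / 2 * ?f ((1 - x) / 2)) has_integral ?C / 2 * (2 * Beta (a + 1 + real k) (b + 1))) {-1<..<1}"
    by (intro has_integral_mult_right) (simp add: has_integral_Icc_iff_Ioo)
  moreover have "?C / 2 * (2 * Beta (a + 1 + real k) (b + 1)) = pochhammer (a + 1) k / pochhammer (a + b + 2) k"
  proof -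
    have "Gamma (a + 1) > 0" "Gamma (b + 1) > 0" "Gamma (a + b + 2) > 0" "Gamma (a + b + 2 + real k) > 0"
      using ab by (auto intro!: Gamma_real_pos)
    moreover have "a + 1 \<notin> \<int>\<^sub>\<le>\<^sub>0" "a + b + 2 \<notin> \<int>\<^sub>\<le>\<^sub>0"
      using ab by (auto dest!: nonpos_Ints_nonpos)
    ultimately show ?thesis
      by (simp add: pochhammer_Gamma Beta_def add_ac divide_simps)
  qed
  moreover have "?C / 2 * ?f ((1 - x) / 2) = jacobi_weight a b x * ((1 - x) / 2) ^ k" if "x \<in> {-1<..<1}" for x
  proof -
    have e1: "1 - (1 - x) / 2 = (1 + x) / 2" by (simp add: field_simps)
    have e2: "((1 - x) / 2) powr (a + real k) = (1 - x) powr a * 2 powr (- a) * ((1 - x) / 2) ^ k"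
      using that by (simp add: powr_add powr_divide powr_minus_divide powr_realpow power_divide)
    have e3: "((1 + x) / 2) powr b = (1 + x) powr b * 2 powr (- b)"
      using that by (simp add: powr_divide powr_minus_divide)
    have e4: "(2::real) powr (- a - b - 1) = 2 powr (- a) * 2 powr (- b) / 2"
      by (simp add: powr_diff powr_minus divide_simps)
    show ?thesis
      unfolding jacobi_weight_def e1 e2 e3 e4 by (simp add: mult_ac)
  qed
  ultimately show ?thesis
    by (metis (no_types, lifting) has_integral_cong)
qed

text \<open>The integrand is nonnegative on \<open>(-1,1)\<close>, so the gauge integral determines
  the nonnegative Lebesgue integral, and integrability follows from its finiteness.\<close>

lemma jacobi_measure_moment:
  assumes ab: "a > -1" "b > -1"
  shows "has_bochner_integral (jacobi_measure a b) (\<lambda>x. ((1 - x) / 2) ^ k)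
    (pochhammer (a + 1) k / pochhammer (a + b + 2) k)"
proof (rule has_bochner_integral_nn_integral)
  show "(\<lambda>x. ((1 - x) / 2) ^ k) \<in> borel_measurable (jacobi_measure a b)"
    by (rule borel_measurable_jacobi_measure) measurable
  show "AE x in jacobi_measure a b. 0 \<le> ((1 - x) / 2) ^ k"
    by (rule AE_I2) auto
  show "0 \<le> pochhammer (a + 1) k / pochhammer (a + b + 2) k"
    using ab by (intro divide_nonneg_nonneg pochhammer_nonneg) auto
  have [measurable]: "jacobi_weight a b \<in> borel_measurable (restrict_space lborel {-1<..<1})"
    using jacobi_weight_measurable by (simp add: measurable_restrict_space1)
  have "(\<integral>\<^sup>+ x. ennreal (((1 - x) / 2) ^ k) \<partial>jacobi_measure a b) =
      (\<integral>\<^sup>+ x. ennreal (jacobi_weight a b x) * ennreal (((1 - x) / 2) ^ k) \<partial>restrict_space lborel {-1<..<1})"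
    unfolding jacobi_measure_def
    by (intro nn_integral_density) (auto intro!: measurable_restrict_space1)
  also have "\<dots> = (\<integral>\<^sup>+ x. ennreal (jacobi_weight a b x) * ennreal (((1 - x) / 2) ^ k) * indicator {-1<..<1} x \<partial>lborel)"
    by (subst nn_integral_restrict_space) auto
  also have "\<dots> = (\<integral>\<^sup>+ x. indicator {-1<..<1} x * ennreal (jacobi_weight a b x * ((1 - x) / 2) ^ k) \<partial>lborel)"
    by (intro nn_integral_cong)
      (auto simp: indicator_def ennreal_mult[OF jacobi_weight_nonneg[OF ab]])
  also have "\<dots> = (\<integral>\<^sup>+ x. ennreal (indicator {-1<..<1} x * (jacobi_weight a b x * ((1 - x) / 2) ^ k)) \<partial>lborel)"
    by (intro nn_integral_cong) (auto simp: indicator_def)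
  also have "\<dots> = pochhammer (a + 1) k / pochhammer (a + b + 2) k"
    using jacobi_weight_nonneg[OF ab]
    by (intro nn_integral_has_integral_lebesgue has_integral_jacobi_weight_power ab) auto
  finally show "(\<integral>\<^sup>+ x. ennreal (((1 - x) / 2) ^ k) \<partial>jacobi_measure a b) =
      ennreal (pochhammer (a + 1) k / pochhammer (a + b + 2) k)" .
qed

section \<open>The moment functional and the symmetry of the Jacobi operator\<close>

definition jacobi_L :: "real \<Rightarrow> real \<Rightarrow> real poly \<Rightarrow> real" where
  "jacobi_L a b p = (LINT x|jacobi_measure a b. poly p ((1 - x) / 2))"

lemma integrable_poly:
  assumes "a > -1" "b > -1"
  shows "integrable (jacobi_measure a b) (\<lambda>x. poly p ((1 - x) / 2))"
  using jacobi_measure_moment[OF assms]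
  by (auto simp: poly_altdef has_bochner_integral_iff)

lemma finite_measure_jacobi_measure:
  assumes "a > -1" "b > -1"
  shows "finite_measure (jacobi_measure a b)"
proof -
  have "integrable (jacobi_measure a b) (\<lambda>x. 1::real)"
    using integrable_poly[OF assms, of 1] by simp
  then show ?thesis
    by (intro finite_measureI) (simp add: integrable_iff_bounded less_top)
qed

lemma poly_monom_induct [case_names monom add]:
  assumes "\<And>c k. P (monom c k)" "\<And>p q. P p \<Longrightarrow> P q \<Longrightarrow> P (p + q)"
  shows "P p"
proof -
  have "P (\<Sum>i\<le>n. monom (coeff p i) i)" for n
    by (induction n) (use assms in auto)
  then show ?thesis by (metis poly_as_sum_of_monoms)
qed

lemma jacobi_L_0: "jacobi_L a b 0 = 0"
  by (simp add: jacobi_L_def)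

text \<open>In the variable \<open>x\<close> this is
  \<open>(1 - x^2) d^2/dx^2 + (b - a - (a + b + 2) x) d/dx\<close>.\<close>

definition jacobi_D :: "real \<Rightarrow> real \<Rightarrow> real poly \<Rightarrow> real poly" where
  "jacobi_D a b p = [:0, 1, -1:] * pderiv (pderiv p) + [:a + 1, - (a + b + 2):] * pderiv p"

lemma jacobi_D_add: "jacobi_D a b (p + q) = jacobi_D a b p + jacobi_D a b q"
  by (simp only: jacobi_D_def pderiv_add distrib_left add_ac)

context
  fixes a b :: real
  assumes a: "a > -1" and b: "b > -1"
begin

lemma jacobi_L_add: "jacobi_L a b (p + q) = jacobi_L a b p + jacobi_L a b q"
  and jacobi_L_diff: "jacobi_L a b (p - q) = jacobi_L a b p - jacobi_L a b q"
  and jacobi_L_smult: "jacobi_L a b (smult c p) = c * jacobi_L a b p"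
  unfolding jacobi_L_def using integrable_poly[OF a b] by simp_all

lemma jacobi_L_monom:
  "jacobi_L a b (monom c k) = c * (pochhammer (a + 1) k / pochhammer (a + b + 2) k)"
  using jacobi_measure_moment[OF a b, of k]
  by (simp add: jacobi_L_def poly_monom has_bochner_integral_iff)

lemma jacobi_L_monom_Suc:
  "jacobi_L a b (monom c (Suc k)) = jacobi_L a b (monom c k) * (a + 1 + real k) / (a + b + 2 + real k)"
  by (simp add: jacobi_L_monom pochhammer_Suc)

text \<open>Multiplying the weight for \<open>(a, b)\<close> by \<open>y\<close> gives a multiple of
  the weight for \<open>(a + 1, b)\<close>. Both have mass one, so the factor is the first
  moment.\<close>

lemma jacobi_L_times_y:
  "jacobi_L a b ([:0, 1:] * p) = (a + 1) / (a + b + 2) * jacobi_L (a + 1) b p"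
proof (induction p rule: poly_monom_induct)
  case (monom c k)
  have "[:0, 1:] * monom c k = monom c (Suc k)"
    by (simp add: monom_Suc)
  moreover have "jacobi_L (a + 1) b (monom c k) = c * (pochhammer (a + 2) k / pochhammer (a + b + 3) k)"
    using jacobi_measure_moment[of "a + 1" b k] a b
    by (simp add: jacobi_L_def poly_monom has_bochner_integral_iff add_ac)
  ultimately show ?case
    by (simp add: jacobi_L_monom pochhammer_rec add_ac)
next
  case (add p q)
  moreover have "jacobi_L (a + 1) b (p + q) = jacobi_L (a + 1) b p + jacobi_L (a + 1) b q"
    unfolding jacobi_L_def using integrable_poly[of "a + 1" b] a b by simp
  ultimately show ?case
    by (simp add: jacobi_L_add ring_distribs del: mult_pCons_left)
qed

lemma jacobi_D_monom_Suc:
  "jacobi_D a b (monom c (Suc k)) = monom (c * (real k + 1) * (real k + 1 + a)) k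
     - monom (c * (real k + 1) * (real k + a + b + 2)) (Suc k)"
proof (rule poly_eqI)
  fix n
  show "coeff (jacobi_D a b (monom c (Suc k))) n = coeff (monom (c * (real k + 1) * (real k + 1 + a)) k
     - monom (c * (real k + 1) * (real k + a + b + 2)) (Suc k)) n"
    by (cases n; cases "n - 1")
      (auto simp: jacobi_D_def coeff_pCons coeff_pderiv coeff_diff algebra_simps split: nat.split)
qed

text \<open>Computed from moments in place of integration by parts; the value is symmetric under
  exchanging \<open>(c, j)\<close> with \<open>(d, k)\<close>. For \<open>j = k = 0\<close> the
  factor \<open>j * k\<close> makes both the truncated \<open>j + k - 1\<close> and a possibly
  vanishing denominator harmless.\<close>

lemma jacobi_L_monom_D_monom:
  "jacobi_L a b (monom c j * jacobi_D a b (monom d k)) =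
    - (real j * real k) * (b + 1) * jacobi_L a b (monom (c * d) (j + k - 1)) / (a + b + 1 + real j + real k)"
proof (cases k)
  case 0
  then show ?thesis by (simp add: jacobi_D_def monom_0 pderiv_pCons jacobi_L_def)
next
  case (Suc i)
  have pos: "a + b + 2 + (real j + real i) > 0" using a b by linarith
  let ?M = "jacobi_L a b (monom (c * d) (j + i))"
  have scale: "jacobi_L a b (monom (c * (d * e)) n) = e * jacobi_L a b (monom (c * d) n)" for e n
    by (simp add: jacobi_L_monom)
  have "monom c j * jacobi_D a b (monom d k) =
      monom (c * (d * ((real i + 1) * (real i + 1 + a)))) (j + i)
      - monom (c * (d * ((real i + 1) * (real i + a + b + 2)))) (Suc (j + i))"
    by (simp add: Suc jacobi_D_monom_Suc right_diff_distrib mult_monom mult_ac)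
  then have "jacobi_L a b (monom c j * jacobi_D a b (monom d k)) =
      (real i + 1) * (real i + 1 + a) * ?M - (real i + 1) * (real i + a + b + 2) *
      (?M * (a + 1 + (real j + real i)) / (a + b + 2 + (real j + real i)))"
    by (simp add: jacobi_L_diff scale jacobi_L_monom_Suc)
  also have "\<dots> = - (real j * (real i + 1)) * (b + 1) * ?M / (a + b + 2 + (real j + real i))"
    using pos by (simp add: divide_simps) algebra
  finally show ?thesis by (simp add: Suc add_ac)
qed

lemma jacobi_L_D_symmetric: "jacobi_L a b (p * jacobi_D a b q) = jacobi_L a b (q * jacobi_D a b p)"
proof (induction p rule: poly_monom_induct)
  case (monom c j)
  show ?case
  proof (induction q rule: poly_monom_induct)
    case (monom d k)
    show ?case by (simp add: jacobi_L_monom_D_monom mult_ac add_ac)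
  next
    case (add p q)
    then show ?case by (simp add: jacobi_D_add ring_distribs jacobi_L_add)
  qed
next
  case (add p q)
  then show ?case by (simp add: jacobi_D_add ring_distribs jacobi_L_add)
qed

lemma jacobi_poly_orthogonal:
  assumes "m \<noteq> n"
  shows "jacobi_L a b (jacobi_poly a b m * jacobi_poly a b n) = 0"
proof -
  let ?l = "\<lambda>n. - real n * (real n + a + b + 1)"
  have D: "jacobi_D a b (jacobi_poly a b n) = smult (?l n) (jacobi_poly a b n)" for n
    unfolding jacobi_D_def by (rule jacobi_poly_ode[OF a])
  have "?l n * jacobi_L a b (jacobi_poly a b m * jacobi_poly a b n) =
      ?l m * jacobi_L a b (jacobi_poly a b m * jacobi_poly a b n)"
    using jacobi_L_D_symmetric[of "jacobi_poly a b m" "jacobi_poly a b n"]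
    unfolding D by (simp only: mult_smult_right jacobi_L_smult mult.commute[of "jacobi_poly a b n"])
  \<comment> \<open>The eigenvalues differ by \<open>(m - n) * (m + n + a + b + 1)\<close>. Since
    \<open>a + b + 1\<close> alone may be negative, positivity of the second factor rests on
    \<open>m + n \<ge> 1\<close>.\<close>
  moreover have "real m + real n + a + b + 1 > 0"
  proof -
    have "m + n \<ge> 1" using assms by simp
    then have "real m + real n \<ge> 1" by linarith
    then show ?thesis using a b by linarith
  qed
  then have "(real m - real n) * (real m + real n + a + b + 1) \<noteq> 0"
    using assms by simp
  then have "?l n \<noteq> ?l m" by algebra
  ultimately show ?thesis by simp
qed

end

section \<open>Squared norms\<close>

lemma jacobi_quot_pos:
  assumes "a > -1" "b > -1"
  shows "jacobi_quot a b n > 0"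
  using assms by (auto simp: jacobi_quot_def intro!: divide_pos_pos)

text \<open>At \<open>n = 0\<close> the divisor \<open>2 * n + a + b + 1\<close> may vanish, so
  \<open>jacobi_poly_connect_a\<close> cannot simply be divided by it. There
  \<open>jacobi_quot\<close> supplies the right value 1.\<close>

lemma jacobi_poly_connect_a':
  assumes "a > -1" "b > -1"
  shows "jacobi_poly a b n = smult (jacobi_quot a b n) (jacobi_poly (a + 1) b n)
    - (if n = 0 then 0
       else smult ((real n + b) / (2 * real n + a + b + 1)) (jacobi_poly (a + 1) b (n - 1)))"
proof (cases "n = 0")
  case True
  then show ?thesis by (simp add: jacobi_poly_0 jacobi_quot_def)
next
  case False
  then have "real n \<ge> 1" by simp
  then have s: "2 * real n + a + b + 1 > 0" using assms by linarith
  have "smult (2 * real n + a + b + 1) (jacobi_poly a b n) = smult (2 * real n + a + b + 1)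
     (smult (jacobi_quot a b n) (jacobi_poly (a + 1) b n)
    - (if n = 0 then 0
       else smult ((real n + b) / (2 * real n + a + b + 1)) (jacobi_poly (a + 1) b (n - 1))))"
    unfolding jacobi_poly_connect_a[OF assms(1)] using s False
    by (simp add: jacobi_quot_def smult_diff_right)
  then show ?thesis using s by (metis smult_cancel order_less_irrefl)
qed

lemma jacobi_h_0: "jacobi_h a b 0 = 1"
  by (simp add: jacobi_h_def jacobi_quot_def)

lemma jacobi_h_Suc:
  assumes "a > -1" "b > -1"
  shows "jacobi_quot a b n * (real n + 1) * (2 * real n + a + b + 3) * jacobi_h a b (Suc n) =
    (real n + 1 + b) * (real n + 1 + a) * jacobi_h a b n"
proof -
  have "pochhammer (a + b + 2) n > 0" "a + b + 2 + real n > 0" "2 * real n + a + b + 3 > 0"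
    using assms by (auto intro!: pochhammer_pos)
  then show ?thesis
    by (simp add: jacobi_h_def jacobi_quot_def[of a b "Suc n"] pochhammer_Suc divide_simps)
       (simp add: algebra_simps)
qed

text \<open>The values of \<open>jacobi_L a b\<close> on \<open>?P n * (?y * ?Q n)\<close> and
  \<open>?P (Suc n) * (?y * ?Q n)\<close> are each found twice: expanding \<open>?P\<close> in
  \<open>?Q\<close> gives multiples of \<open>N\<close>, and expanding \<open>?y * ?Q n\<close> in
  \<open>?P\<close> gives multiples of the wanted norms. Eliminating \<open>N\<close> leaves the
  recursion \<open>jacobi_h_Suc\<close>.\<close>

lemma jacobi_poly_norm:
  assumes ab: "a > -1" "b > -1"
  shows "jacobi_L a b (jacobi_poly a b n * jacobi_poly a b n) = jacobi_h a b n"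
proof (induction n)
  case 0
  show ?case using jacobi_L_monom[OF ab, of 1 0]
    by (simp add: jacobi_poly_0 jacobi_h_0)
next
  case (Suc n)
  let ?P = "jacobi_poly a b" and ?Q = "jacobi_poly (a + 1) b" and ?y = "[:0, 1:] :: real poly"
  note lin = jacobi_L_add[OF ab] jacobi_L_diff[OF ab] jacobi_L_smult[OF ab] jacobi_L_0
  \<comment> \<open>The extra factor \<open>?y\<close> turns the functional into the one for
    \<open>(a + 1, b)\<close>, for which the \<open>?Q\<close> are orthogonal.\<close>
  have orth: "jacobi_L a b (?Q m * (?y * ?Q k)) = 0" if "m \<noteq> k" for m k
    using jacobi_poly_orthogonal[of "a + 1" b m k] that ab
      jacobi_L_times_y[OF ab, of "?Q m * ?Q k"] by (simp only: mult.left_commute) simp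
  define N where "N = jacobi_L a b (?Q n * (?y * ?Q n))"
  have s: "2 * real n + a + b + 2 > 0" "2 * real n + a + b + 3 > 0" using ab by linarith+
  have "jacobi_L a b (?P n * (?y * ?Q n)) = jacobi_quot a b n * N"
    unfolding jacobi_poly_connect_a'[OF ab, of n]
    by (simp add: left_diff_distrib lin orth N_def del: mult_pCons_left)
  moreover have "(2 * real n + a + b + 2) * jacobi_L a b (?P n * (?y * ?Q n)) = (real n + a + 1) * jacobi_h a b n"
  proof -
    have "(2 * real n + a + b + 2) * jacobi_L a b (?P n * (?y * ?Q n)) =
       jacobi_L a b (?P n * smult (2 * real n + a + b + 2) (?y * ?Q n))"
      by (simp only: lin mult_smult_right)
    also have "\<dots> = (real n + a + 1) * jacobi_h a b n"
      unfolding jacobi_poly_times_y[OF ab(1)]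
      by (simp add: right_diff_distrib lin Suc.IH jacobi_poly_orthogonal[OF ab])
    finally show ?thesis .
  qed
  moreover have "(2 * real n + a + b + 3) * jacobi_L a b (?P (Suc n) * (?y * ?Q n)) = - (real n + 1 + b) * N"
  proof -
    have "(2 * real n + a + b + 3) * jacobi_L a b (?P (Suc n) * (?y * ?Q n)) =
       jacobi_L a b (smult (2 * real (Suc n) + a + b + 1) (?P (Suc n)) * (?y * ?Q n))"
      by (simp add: lin mult_smult_left add_ac del: mult_pCons_left mult_pCons_right)
    also have "\<dots> = - (real n + 1 + b) * N"
      unfolding jacobi_poly_connect_a[OF ab(1)]
      by (simp add: left_diff_distrib lin orth N_def del: mult_pCons_left mult_pCons_right)
        (simp_all add: algebra_simps)
    finally show ?thesis .
  qed
  moreover have "(2 * real n + a + b + 2) * jacobi_L a b (?P (Suc n) * (?y * ?Q n)) =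
      - (real n + 1) * jacobi_L a b (?P (Suc n) * ?P (Suc n))"
  proof -
    have "(2 * real n + a + b + 2) * jacobi_L a b (?P (Suc n) * (?y * ?Q n)) =
       jacobi_L a b (?P (Suc n) * smult (2 * real n + a + b + 2) (?y * ?Q n))"
      by (simp only: lin mult_smult_right)
    also have "\<dots> = - (real n + 1) * jacobi_L a b (?P (Suc n) * ?P (Suc n))"
      unfolding jacobi_poly_times_y[OF ab(1)]
      by (simp add: right_diff_distrib lin jacobi_poly_orthogonal[OF ab])
        (simp add: algebra_simps)
    finally show ?thesis .
  qed
  ultimately have "jacobi_quot a b n * (real n + 1) * (2 * real n + a + b + 3) * jacobi_L a b (?P (Suc n) * ?P (Suc n)) =
    (real n + 1 + b) * (real n + 1 + a) * jacobi_h a b n"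
    by algebra
  also have "\<dots> = jacobi_quot a b n * (real n + 1) * (2 * real n + a + b + 3) * jacobi_h a b (Suc n)"
    by (rule jacobi_h_Suc[OF ab, symmetric])
  finally show ?case using jacobi_quot_pos[OF ab, of n] s by simp
qed

lemma jacobi_h_pos:
  assumes "a > -1" "b > -1"
  shows "jacobi_h a b n > 0"
  unfolding jacobi_h_def using assms jacobi_quot_pos[OF assms, of n]
  by (auto intro!: mult_pos_pos divide_pos_pos pochhammer_pos)

section \<open>Completeness\<close>

lemma integrable_mult_bounded:
  fixes f :: "'a \<Rightarrow> complex" and g :: "'a \<Rightarrow> real"
  assumes "integrable M f" "g \<in> borel_measurable M" "\<And>x. x \<in> space M \<Longrightarrow> \<bar>g x\<bar> \<le> B"
  shows "integrable M (\<lambda>x. f x * of_real (g x))"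
proof (rule Bochner_Integration.integrable_bound)
  show "integrable M (\<lambda>x. B * norm (f x))"
    using assms(1) by simp
  have "f \<in> borel_measurable M" using assms(1) by simp
  then show "(\<lambda>x. f x * of_real (g x)) \<in> borel_measurable M"
    using assms(2) by measurable
  have "norm (f x * of_real (g x)) \<le> norm (B * norm (f x))" if "x \<in> space M" for x
    using mult_left_mono[OF assms(3)[OF that], of "norm (f x)"] assms(3)[OF that]
    by (simp add: norm_mult abs_mult mult.commute)
  then show "AE x in M. norm (f x * of_real (g x)) \<le> norm (B * norm (f x))"
    by (rule AE_I2)
qed

context
  fixes M :: "real measure" and S :: "real set" and l u :: real and f :: "real \<Rightarrow> complex"
  assumes fin: "finite_measure M"
    and sets: "sets M = sets (restrict_space borel S)" and S: "S \<in> sets borel" "S \<subseteq> {l..u}"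
    and f: "integrable M f"
begin

lemma space_eq_S: "space M = S"
  using sets_eq_imp_space_eq[OF sets] by (simp add: space_restrict_space)

lemma measurable_if_borel: "g \<in> borel_measurable borel \<Longrightarrow> g \<in> borel_measurable M"
  using measurable_cong_sets[OF sets refl] by (auto intro: measurable_restrict_space1)

lemma integrable_times_continuous:
  assumes "continuous_on UNIV g"
  shows "integrable M (\<lambda>x. f x * of_real (g x))"
proof -
  have "bounded (g ` {l..u})"
    using assms
    by (intro compact_imp_bounded compact_continuous_image continuous_on_subset[OF assms]) auto
  then obtain B where "\<forall>x\<in>{l..u}. \<bar>g x\<bar> \<le> B"
    unfolding bounded_iff by auto
  then show ?thesis
    using S assms by (intro integrable_mult_bounded[of _ _ _ B] f measurable_if_borel borel_measurable_continuous_onI)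
      (auto simp: space_eq_S)
qed

context
  assumes orth: "\<And>p :: real poly. (LINT x|M. f x * of_real (poly p x)) = 0"
begin

text \<open>Replacing \<open>g\<close> by a polynomial uniformly \<open>e\<close>-close on
  \<open>{l..u}\<close> changes the integral by at most \<open>e\<close> times the
  \<open>L^1\<close> norm of \<open>f\<close>.\<close>

lemma orthogonal_continuous:
  assumes g: "continuous_on UNIV g"
  shows "(LINT x|M. f x * of_real (g x)) = 0"
proof -
  let ?I = "LINT x|M. norm (f x)"
  have bound: "norm (LINT x|M. f x * of_real (g x)) \<le> e * ?I" if "e > 0" for e
  proof -
    have "\<exists>h. (\<exists>p. h = poly p) \<and> (\<forall>x\<in>{l..u}. \<bar>g x - h x\<bar> < e)"
    proof (rule Stone_Weierstrass_HOL)
      show "\<exists>p. (\<lambda>x. c) = poly p" for c :: real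
        by (rule exI[of _ "[:c:]"]) auto
      show "\<exists>p. (\<lambda>x. h x + k x) = poly p"
        if "(\<exists>p. h = poly p) \<and> (\<exists>p. k = poly p)" for h k :: "real \<Rightarrow> real"
        using that by (auto simp: fun_eq_iff simp flip: poly_add)
      show "\<exists>p. (\<lambda>x. h x * k x) = poly p"
        if "(\<exists>p. h = poly p) \<and> (\<exists>p. k = poly p)" for h k :: "real \<Rightarrow> real"
        using that by (auto simp: fun_eq_iff simp flip: poly_mult)
      show "\<exists>h. (\<exists>p. h = poly p) \<and> h x \<noteq> h y"
        if "x \<in> {l..u} \<and> y \<in> {l..u} \<and> x \<noteq> y" for x y
        using that by (intro exI[of _ "poly [:0, 1:]"]) auto
    qed (use that in \<open>auto intro: continuous_on_subset[OF g] continuous_intros\<close>)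
    then obtain p where p: "\<And>x. x \<in> {l..u} \<Longrightarrow> \<bar>g x - poly p x\<bar> < e" by blast
    have int: "integrable M (\<lambda>x. f x * of_real (g x))" "integrable M (\<lambda>x. f x * of_real (poly p x))"
      by (intro integrable_times_continuous g continuous_intros)+
    then have "(LINT x|M. f x * of_real (g x)) = (LINT x|M. f x * of_real (g x - poly p x))"
      using orth[of p] by (simp add: right_diff_distrib)
    also have "norm \<dots> \<le> (LINT x|M. norm (f x * of_real (g x - poly p x)))"
      by (rule integral_norm_bound)
    also have "\<dots> \<le> (LINT x|M. e * norm (f x))"
    proof (rule integral_mono)
      show "integrable M (\<lambda>x. norm (f x * of_real (g x - poly p x)))"
        by (intro integrable_norm integrable_times_continuous continuous_intros g)
      show "integrable M (\<lambda>x. e * norm (f x))" using f by simp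
      show "norm (f x * of_real (g x - poly p x)) \<le> e * norm (f x)" if "x \<in> space M" for x
      proof -
        have "x \<in> {l..u}" using that S by (auto simp: space_eq_S)
        from less_imp_le[OF p[OF this]] show ?thesis
          unfolding norm_mult norm_of_real by (subst mult.commute) (rule mult_right_mono, auto)
      qed
    qed
    finally show ?thesis by simp
  qed
  have "norm (LINT x|M. f x * of_real (g x)) \<le> 0"
  proof (rule field_le_epsilon)
    fix d :: real assume "d > 0"
    moreover have "?I \<ge> 0" by simp
    moreover from this have "?I + 1 > 0" by linarith
    \<comment> \<open>Dividing by \<open>?I + 1\<close> instead of \<open>?I\<close> covers the case
      \<open>?I = 0\<close>.\<close>
    ultimately have "d / (?I + 1) > 0" "d / (?I + 1) * ?I \<le> d"
      by (simp, simp add: field_simps)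
    with bound[of "d / (?I + 1)"] show "norm (LINT x|M. f x * of_real (g x)) \<le> 0 + d" by simp
  qed
  then show ?thesis by simp
qed

text \<open>The indicator of a half-line is a pointwise limit of continuous functions with values in
  \<open>[0,1]\<close>, and \<open>norm (f x)\<close> dominates.\<close>

lemma orthogonal_greaterThan: "(LINT x:({c<..} \<inter> S)|M. f x) = 0"
proof -
  \<comment> \<open>For \<open>n > 0\<close>, a ramp that is 0 up to \<open>c\<close>, rises with
    slope \<open>n\<close>, and is 1 from \<open>c + 1 / n\<close> on.\<close>
  let ?g = "\<lambda>(n::nat) x. min 1 (max 0 (real n * (x - c)))"
  have lim: "(\<lambda>n. ?g n x) \<longlonglongrightarrow> indicator {c<..} x" for x
  proof (cases "x > c")
    case True
    obtain N :: nat where N: "1 / (x - c) < real N" using reals_Archimedean2 by blast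
    have "\<forall>\<^sub>F n in sequentially. ?g n x = 1"
      using eventually_ge_at_top[of N]
    proof eventually_elim
      case (elim n)
      then have "1 / (x - c) \<le> real n" using N by simp
      then have "1 \<le> real n * (x - c)" using True by (simp add: field_simps)
      then show ?case by simp
    qed
    then show ?thesis using True by (simp add: tendsto_eventually)
  next
    case False
    then have "?g n x = 0" for n
      using mult_nonneg_nonpos[of "real n" "x - c"] by simp
    then show ?thesis using False by simp
  qed
  have "(\<lambda>n. LINT x|M. f x * of_real (?g n x)) \<longlonglongrightarrow> (LINT x|M. f x * of_real (indicator {c<..} x))"
  proof (rule integral_dominated_convergence[where w = "\<lambda>x. norm (f x)"])
    have [measurable]: "f \<in> borel_measurable M" using f by simp
    have [measurable]: "(\<lambda>x. indicator {c<..} x :: real) \<in> borel_measurable M"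
      by (rule measurable_if_borel) measurable
    show "(\<lambda>x. f x * of_real (indicator {c<..} x)) \<in> borel_measurable M" by measurable
    have [measurable]: "?g n \<in> borel_measurable M" for n
      by (rule measurable_if_borel) measurable
    show "(\<lambda>x. f x * of_real (?g n x)) \<in> borel_measurable M" for n by measurable
    show "integrable M (\<lambda>x. norm (f x))" using f by simp
    show "AE x in M. (\<lambda>n. f x * of_real (?g n x)) \<longlonglongrightarrow> f x * of_real (indicator {c<..} x)"
      by (intro AE_I2 tendsto_intros lim)
    show "AE x in M. norm (f x * of_real (?g n x)) \<le> norm (f x)" for n
      by (intro AE_I2) (auto simp: norm_mult intro!: mult_left_le)
  qed
  moreover have "(LINT x|M. f x * of_real (?g n x)) = 0" for n
    by (intro orthogonal_continuous continuous_intros)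
  ultimately have "(LINT x|M. f x * of_real (indicator {c<..} x)) = 0"
    by (simp add: LIMSEQ_const_iff)
  then show ?thesis
    unfolding set_lebesgue_integral_def
    by (subst (asm) Bochner_Integration.integral_cong[OF refl, where g = "\<lambda>x. indicator ({c<..} \<inter> S) x *\<^sub>R f x"])
      (auto simp: space_eq_S indicator_def)
qed

text \<open>The half-lines are an intersection-stable generator of the Borel sets, and the sets over
  which \<open>f\<close> integrates to zero form a Dynkin system. Hence the integral over every
  measurable set vanishes, which forces \<open>f\<close> to be null.\<close>

lemma AE_eq_0_if_orthogonal_polys: "AE x in M. f x = 0"
proof -
  interpret finite_measure M by (rule fin)
  have sets_Int: "A \<inter> S \<in> sets M" if "A \<in> sets borel" for A
    using that S by (auto simp: sets sets_restrict_space)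
  have int: "set_integrable M (A \<inter> S) f" if "A \<in> sets borel" for A
    unfolding set_integrable_def by (intro integrable_mult_indicator sets_Int that f)
  have "(LINT x:(A \<inter> S)|M. f x) = 0" if "A \<in> sets borel" for A
  proof -
    have A: "A \<in> sigma_sets UNIV (range greaterThan)"
      using that unfolding borel_Ioi by (simp add: sets_measure_of)
    have stable: "Int_stable (range (greaterThan :: real \<Rightarrow> real set))"
    proof -
      have "{c<..} \<inter> {d<..} = {max c d<..}" for c d :: real by auto
      then show ?thesis by (auto simp: Int_stable_def)
    qed
    have closed: "range (greaterThan :: real \<Rightarrow> real set) \<subseteq> Pow UNIV" by simp
    from stable closed A show ?thesis
    proof (induction rule: sigma_sets_induct_disjoint)
      case (basic A)
      then show ?case using orthogonal_greaterThan by auto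
    next
      case empty
      show ?case by (simp add: set_lebesgue_integral_def)
    next
      case (compl A)
      then have A: "A \<in> sets borel" unfolding borel_Ioi by (simp add: sets_measure_of)
      have "(LINT x:(A \<inter> S)|M. f x) + (LINT x:((UNIV - A) \<inter> S)|M. f x) = (LINT x:((A \<inter> S) \<union> ((UNIV - A) \<inter> S))|M. f x)"
        using A by (intro set_integral_Un[symmetric] int) auto
      also have "(A \<inter> S) \<union> ((UNIV - A) \<inter> S) = S" by auto
      also have "(LINT x:S|M. f x) = (LINT x|M. f x)"
        using set_integral_space[OF f] by (simp add: space_eq_S)
      \<comment> \<open>Closure under complements needs the total integral to vanish, which is
        orthogonality to the constant polynomial 1.\<close>
      also have "\<dots> = 0" using orth[of 1] by simp
      finally show ?case using compl by simp
    next
      case (union A)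
      then have A: "A i \<in> sets borel" for i unfolding borel_Ioi by (auto simp: sets_measure_of)
      have eq: "(\<Union>i. A i) \<inter> S = (\<Union>i. A i \<inter> S)" by auto
      have "(\<Union>i. A i) \<in> sets borel" using A by (intro sets.countable_UN) auto
      then have "set_integrable M (\<Union>i. A i \<inter> S) f"
        unfolding eq[symmetric] by (rule int)
      then have "(LINT x:(\<Union>i. A i \<inter> S)|M. f x) = (\<Sum>i. LINT x:(A i \<inter> S)|M. f x)"
        using sets_Int[OF A] union(1)
        by (intro lebesgue_integral_countable_add) (auto simp: disjoint_family_on_def)
      then show ?case unfolding eq using union(3) by simp
    qed
  qed
  then show ?thesis
    by (intro density_zero f) (auto simp: sets sets_restrict_space Int_commute)
qed

end

end

section \<open>The functions \<open>jacobi_phi\<close> as an orthonormal basis\<close>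

lemma jacobi_phi_poly:
  "jacobi_phi a b n x = of_real (poly (jacobi_poly a b n) ((1 - x) / 2) / sqrt (jacobi_h a b n))"
  by (simp add: jacobi_phi_def poly_jacobi_poly)

lemma jacobi_phi_measurable: "jacobi_phi a b n \<in> borel_measurable (jacobi_measure a b)"
proof -
  have [measurable]: "(\<lambda>x. poly (jacobi_poly a b n) ((1 - x) / 2)) \<in> borel_measurable borel"
    by (intro borel_measurable_continuous_onI continuous_intros) auto
  show ?thesis
    unfolding jacobi_phi_poly by (intro borel_measurable_jacobi_measure) measurable
qed

lemma jacobi_phi_mult:
  "jacobi_phi a b m x * cnj (jacobi_phi a b n x) =
    of_real (poly (jacobi_poly a b m * jacobi_poly a b n) ((1 - x) / 2)
      / (sqrt (jacobi_h a b m) * sqrt (jacobi_h a b n)))"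
  by (simp add: jacobi_phi_poly)

lemma jacobi_phi_L2:
  assumes ab: "a > -1" "b > -1"
  shows "jacobi_phi a b n \<in> L2_space (jacobi_measure a b)"
proof -
  have "(cmod (jacobi_phi a b n x))\<^sup>2 =
      poly (jacobi_poly a b n * jacobi_poly a b n) ((1 - x) / 2) / jacobi_h a b n" for x
    using jacobi_h_pos[OF ab, of n] unfolding jacobi_phi_poly norm_of_real
    by (simp add: power_divide power2_eq_square)
  then show ?thesis
    using integrable_poly[OF ab, of "jacobi_poly a b n * jacobi_poly a b n"]
    by (simp add: L2_space_def jacobi_phi_measurable del: poly_mult)
qed

lemma jacobi_phi_orthonormal:
  assumes ab: "a > -1" "b > -1"
  shows "L2_inner (jacobi_measure a b) (jacobi_phi a b m) (jacobi_phi a b n) = (if m = n then 1 else 0)"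
proof -
  have "L2_inner (jacobi_measure a b) (jacobi_phi a b m) (jacobi_phi a b n) =
    of_real (jacobi_L a b (jacobi_poly a b m * jacobi_poly a b n)
      / (sqrt (jacobi_h a b m) * sqrt (jacobi_h a b n)))"
    unfolding L2_inner_def jacobi_phi_mult jacobi_L_def by (simp del: poly_mult of_real_divide)
  then show ?thesis
    using jacobi_h_pos[OF ab, of n] jacobi_poly_norm[OF ab, of n] jacobi_poly_orthogonal[OF ab, of m n]
    by (auto simp flip: of_real_mult)
qed

text \<open>The leading coefficient: its being nonzero allows every polynomial to be reduced by
  Jacobi polynomials. For \<open>n \<ge> 1\<close> the base \<open>n + a + b + 1\<close> is
  positive; \<open>n = 0\<close> is separate because there it may be zero or negative.\<close>

lemma jacobi_c_diag_neq_0: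
  assumes "a > -1" "b > -1"
  shows "jacobi_c a b n n \<noteq> 0"
proof (cases "n = 0")
  case True
  then show ?thesis by (simp add: jacobi_c_def)
next
  case False
  then have "real n \<ge> 1" by simp
  then have "pochhammer (real n + a + b + 1) n > 0" "pochhammer (a + 1) n > 0"
    using assms by (auto intro!: pochhammer_pos)
  then show ?thesis by (simp add: jacobi_c_def pochhammer_of_nat_eq_0_iff)
qed

text \<open>On a finite measure space this follows from \<open>t \<le> 1 + t^2\<close>.\<close>

lemma L2_space_integrable:
  assumes "finite_measure M" "f \<in> L2_space M"
  shows "integrable M f"
proof (rule Bochner_Integration.integrable_bound)
  interpret finite_measure M by fact
  show "integrable M (\<lambda>x. 1 + (cmod (f x))\<^sup>2)" "f \<in> borel_measurable M"
    using assms(2) by (auto simp: L2_space_def)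
  have "t \<le> 1 + t\<^sup>2" for t :: real
    using zero_le_power2[of "t - 1/2"] by (simp add: power2_eq_square algebra_simps)
  then show "AE x in M. norm (f x) \<le> norm (1 + (cmod (f x))\<^sup>2)"
    by (intro AE_I2) auto
qed

text \<open>Jacobi polynomials span all polynomials, so \<open>f\<close> annihilates every
  polynomial and \<open>AE_eq_0_if_orthogonal_polys\<close> applies.\<close>

lemma jacobi_phi_complete:
  assumes ab: "a > -1" "b > -1" and f: "f \<in> L2_space (jacobi_measure a b)"
    and orth: "\<And>n. L2_inner (jacobi_measure a b) f (jacobi_phi a b n) = 0"
  shows "AE x in jacobi_measure a b. f x = 0"
proof -
  let ?M = "jacobi_measure a b"
  note fin = finite_measure_jacobi_measure[OF ab]
  note f_int = L2_space_integrable[OF fin f]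
  let ?F = "\<lambda>p. LINT x|?M. f x * of_real (poly p ((1 - x) / 2))"
  have S: "{-1<..<1::real} \<in> sets borel" "{-1<..<1::real} \<subseteq> {-1..1}" by auto
  have int: "integrable ?M (\<lambda>x. f x * of_real (poly p ((1 - x) / 2)))" for p
    by (rule integrable_times_continuous[OF fin sets_jacobi_measure S f_int]) (intro continuous_intros, auto)
  have F_phi: "?F (jacobi_poly a b n) = 0" for n
  proof -
    have "0 = sqrt (jacobi_h a b n) * L2_inner ?M f (jacobi_phi a b n)"
      using orth by simp
    also have "\<dots> = (LINT x|?M. sqrt (jacobi_h a b n) * (f x * cnj (jacobi_phi a b n x)))"
      by (simp add: L2_inner_def)
    also have "\<dots> = ?F (jacobi_poly a b n)"
      using jacobi_h_pos[OF ab, of n]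
      by (intro Bochner_Integration.integral_cong) (auto simp: jacobi_phi_poly simp flip: of_real_mult)
    finally show ?thesis ..
  qed
  \<comment> \<open>Here \<open>n\<close> bounds the number of coefficients rather than the degree,
    so the induction starts at the zero polynomial.\<close>
  have F_poly: "?F p = 0" if "\<And>k. n \<le> k \<Longrightarrow> coeff p k = 0" for n p
    using that
  proof (induction n arbitrary: p)
    case 0
    then have "p = 0" by (simp add: poly_eq_iff)
    then show ?case by simp
  next
    case (Suc n)
    define c where "c = coeff p n / jacobi_c a b n n"
    let ?q = "p - smult c (jacobi_poly a b n)"
    have "coeff ?q k = 0" if "n \<le> k" for k
      using that Suc.prems jacobi_c_diag_neq_0[OF ab, of n]
      by (cases "k = n") (auto simp: coeff_jacobi_poly jacobi_c_eq_0 c_def)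
    then have "?F ?q = 0" by (rule Suc.IH)
    moreover have "?F ?q = ?F p - of_real c * ?F (jacobi_poly a b n)"
      using int[of p] int[of "jacobi_poly a b n"]
      by (simp add: right_diff_distrib mult.left_commute[of "f _"])
    ultimately show ?case by (simp add: F_phi)
  qed
  have "(LINT x|?M. f x * of_real (poly p x)) = 0" for p
  proof -
    \<comment> \<open>A polynomial in \<open>x\<close> is rewritten as one in \<open>y\<close> by
      \<open>x = 1 - 2 * y\<close>.\<close>
    have "poly p x = poly (pcompose p [:1, -2:]) ((1 - x) / 2)" for x
      by (simp add: poly_pcompose field_simps)
    moreover have "?F (pcompose p [:1, -2:]) = 0"
      by (rule F_poly[of "Suc (degree (pcompose p [:1, -2:]))"]) (simp add: coeff_eq_0)
    ultimately show ?thesis by simp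
  qed
  then show ?thesis
    by (rule AE_eq_0_if_orthogonal_polys[OF fin sets_jacobi_measure S f_int])
qed

lemma jacobi_phi_orthonormal_basis:
  assumes "a > -1" "b > -1"
  shows "L2_orthonormal_basis (jacobi_measure a b) (jacobi_phi a b)"
  unfolding L2_orthonormal_basis_def
  using jacobi_phi_L2[OF assms] jacobi_phi_orthonormal[OF assms] jacobi_phi_complete[OF assms] by blast

section \<open>The five-diagonal action\<close>

lemma jacobi_K_pos:
  assumes "a > -1" "b > -1"
  shows "jacobi_K a b > 0"
  unfolding jacobi_K_def using assms by (auto intro!: divide_pos_pos mult_pos_pos)

lemma pochhammer_add_2:
  "(z :: real) * (z + 1) * pochhammer (z + 2) n = pochhammer z n * (z + real n) * (z + real n + 1)"
proof -
  have "z * ((z + 1) * pochhammer (z + 1 + 1) n) = z * (pochhammer (z + 1) n * (z + 1 + real n))"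
    by (simp only: pochhammer_shift)
  also have "\<dots> = pochhammer z n * (z + real n) * (z + 1 + real n)"
    using pochhammer_shift[of z n] by simp
  finally show ?thesis by (simp add: add_ac mult_ac)
qed

text \<open>\<open>jacobi_K\<close> is the mean of \<open>1 - x^2\<close> under the normalised
  weight, that is, the factor relating \<open>1 - x^2\<close> times the weight for
  \<open>(a, b)\<close> to the weight for \<open>(a + 1, b + 1)\<close>. This lemma and the next two
  compare the norms at \<open>n\<close>, \<open>n + 1\<close> and \<open>n + 2\<close>; they provide
  the squares of \<open>jacobi_alpha\<close>, \<open>jacobi_beta\<close> and
  \<open>jacobi_gamma\<close> respectively.\<close>

lemma jacobi_h_raise:
  assumes "a > -1" "b > -1"
  shows "jacobi_K a b * jacobi_quot a b n * (real n + a + b + 2) * (2 * real n + a + b + 3) * jacobi_h (a + 1) (b + 1) n =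
    4 * (a + 1 + real n) * (b + 1 + real n) * jacobi_h a b n"
proof -
  \<comment> \<open>For the raised parameters the case \<open>n = 0\<close> is not exceptional: the
    quotient equals 1 there, as \<open>a + b + 3 > 0\<close>.\<close>
  have quot: "jacobi_quot (a + 1) (b + 1) n = (real n + a + b + 3) / (2 * real n + a + b + 3)"
    using assms by (simp add: jacobi_quot_def add_ac)
  have pos: "a + 1 > 0" "b + 1 > 0" "a + b + 2 > 0" "a + b + 3 > 0" "2 * real n + a + b + 3 > 0"
    "a + b + 2 + real n > 0" "a + b + 3 + real n > 0" "pochhammer (a + b + 2) n > 0"
    using assms by (auto intro!: pochhammer_pos)
  have A: "pochhammer (a + 2) n = pochhammer (a + 1) n * (a + 1 + real n) / (a + 1)"
    using pochhammer_shift[of "a + 1" n] pos by (simp add: field_simps)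
  have B: "pochhammer (b + 2) n = pochhammer (b + 1) n * (b + 1 + real n) / (b + 1)"
    using pochhammer_shift[of "b + 1" n] pos by (simp add: field_simps)
  have "(a + b + 2) * (a + b + 3) * pochhammer (a + b + 4) n
      = pochhammer (a + b + 2) n * (a + b + 2 + real n) * (a + b + 3 + real n)"
    using pochhammer_add_2[of "a + b + 2" n] by (simp add: add_ac)
  then have C: "pochhammer (a + b + 4) n = pochhammer (a + b + 2) n * (a + b + 2 + real n) * (a + b + 3 + real n)
      / ((a + b + 2) * (a + b + 3))"
    using pos by (subst eq_divide_eq) (simp add: mult_ac)
  have h: "jacobi_h (a + 1) (b + 1) n = (real n + a + b + 3) / (2 * real n + a + b + 3) *
    (pochhammer (a + 2) n * pochhammer (b + 2) n / (pochhammer (a + b + 4) n * fact n))"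
    unfolding jacobi_h_def quot by (simp add: add_ac)
  have r: "real n + a + b + 2 = a + b + 2 + real n" "real n + a + b + 3 = a + b + 3 + real n" by simp_all
  show ?thesis
    unfolding h A B C unfolding jacobi_h_def jacobi_K_def r using pos
    by (simp add: divide_simps) (simp add: algebra_simps)
qed

lemma jacobi_h_raise_lower:
  assumes "a > -1" "b > -1"
  shows "jacobi_K a b * (real n + a + b + 2) * jacobi_h (a + 1) (b + 1) n = 4 * (real n + 1) * jacobi_h a b (Suc n)"
proof -
  have "2 * real n + a + b + 3 > 0" using assms by linarith
  moreover have "jacobi_quot a b n > 0" by (rule jacobi_quot_pos[OF assms])
  moreover have "jacobi_quot a b n * (2 * real n + a + b + 3) * (jacobi_K a b * (real n + a + b + 2) * jacobi_h (a + 1) (b + 1) n) =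
    jacobi_quot a b n * (2 * real n + a + b + 3) * (4 * (real n + 1) * jacobi_h a b (Suc n))"
    using jacobi_h_raise[OF assms, of n] jacobi_h_Suc[OF assms, of n] by algebra
  ultimately show ?thesis by simp
qed

lemma jacobi_h_raise_lower2:
  assumes "a > -1" "b > -1"
  shows "jacobi_K a b * (2 * real n + a + b + 3) * (real n + 2 + a) * (real n + 2 + b) * jacobi_h (a + 1) (b + 1) n =
     4 * (2 * real n + a + b + 5) * (real n + 1) * (real n + 2) * jacobi_h a b (Suc (Suc n))"
proof -
  have pos: "2 * real n + a + b + 3 > 0" "real n + a + b + 2 > 0" using assms by linarith+
  have "(real n + a + b + 2) * (real n + 2) * (2 * real n + a + b + 5) * jacobi_h a b (Suc (Suc n)) =
    (2 * real n + a + b + 3) * (real n + 2 + b) * (real n + 2 + a) * jacobi_h a b (Suc n)"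
    using jacobi_h_Suc[OF assms, of "Suc n"] pos
    by (simp add: jacobi_quot_def divide_simps) (simp add: algebra_simps)
  then have "(real n + a + b + 2) * (jacobi_K a b * (2 * real n + a + b + 3) * (real n + 2 + a) * (real n + 2 + b) * jacobi_h (a + 1) (b + 1) n) =
    (real n + a + b + 2) * (4 * (2 * real n + a + b + 5) * (real n + 1) * (real n + 2) * jacobi_h a b (Suc (Suc n)))"
    using jacobi_h_raise_lower[OF assms, of n] by algebra
  then show ?thesis using pos by simp
qed

text \<open>Takes square roots in a norm identity, with the prefactor \<open>2 / sqrt K\<close>
  common to the three coefficient families.\<close>

lemma sqrt_mult_eqI:
  assumes "0 \<le> c" "0 < k" "4 * x * h = k * c\<^sup>2 * g"
  shows "2 / sqrt k * sqrt x * sqrt h = c * sqrt g"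
proof -
  have "sqrt (4 * x * h) = sqrt (k * c\<^sup>2 * g)" using assms(3) by simp
  then have "2 * sqrt x * sqrt h = sqrt k * c * sqrt g"
    using assms(1) by (simp add: real_sqrt_mult)
  then show ?thesis using assms(2) by (simp add: field_simps)
qed

text \<open>Here and in the next two lemmas the roots are absorbed into the norm quotient of
  \<open>(a + 1, b + 1)\<close> and \<open>(a, b)\<close>. The remaining rational factor is, up to
  the sign in the \<open>jacobi_gamma\<close> case, the one in
  \<open>jacobi_poly_connect\<close>.\<close>

lemma jacobi_alpha_altdef:
  assumes ab: "a > -1" "b > -1"
  shows "jacobi_alpha a b n * sqrt (jacobi_h a b n) =
    jacobi_quot a b n * (real n + a + b + 2) / (2 * real n + a + b + 2) * sqrt (jacobi_h (a + 1) (b + 1) n)"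
proof -
  let ?X = "jacobi_quot a b n * ((a + real n + 1) * (b + real n + 1) * (real n + a + b + 2)
     / (a + b + 2 * real n + 3))"
  have pos: "a + b + 2 * real n + 3 > 0" "real n + a + b + 2 > 0" using ab by linarith+
  have "(a + b + 2 * real n + 3) * ?X = jacobi_quot a b n * (a + real n + 1) * (b + real n + 1) * (real n + a + b + 2)"
    using pos by simp
  then have "(a + b + 2 * real n + 3) * (4 * ?X * jacobi_h a b n) =
    (a + b + 2 * real n + 3) * (jacobi_K a b * (jacobi_quot a b n * (real n + a + b + 2))\<^sup>2 * jacobi_h (a + 1) (b + 1) n)"
    using jacobi_h_raise[OF ab, of n] by algebra
  then have "2 / sqrt (jacobi_K a b) * sqrt ?X * sqrt (jacobi_h a b n) =
    jacobi_quot a b n * (real n + a + b + 2) * sqrt (jacobi_h (a + 1) (b + 1) n)"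
    using pos jacobi_K_pos[OF ab] jacobi_quot_pos[OF ab, of n] by (intro sqrt_mult_eqI) auto
  from arg_cong[OF this, of "\<lambda>t. t / (2 * real n + a + b + 2)"] show ?thesis
    by (simp add: jacobi_alpha_def mult_ac)
qed

lemma jacobi_beta_altdef:
  assumes ab: "a > -1" "b > -1"
  shows "jacobi_beta a b (Suc n) * sqrt (jacobi_h a b (Suc n)) =
    (a - b) * (real n + a + b + 2) / ((2 * real n + a + b + 2) * (2 * real n + a + b + 4)) * sqrt (jacobi_h (a + 1) (b + 1) n)"
proof -
  let ?Y = "real (Suc n) * (real (Suc n) + a + b + 1)"
  have pos: "real n + a + b + 2 > 0" using ab by linarith
  have "4 * ?Y * jacobi_h a b (Suc n) = jacobi_K a b * (real n + a + b + 2)\<^sup>2 * jacobi_h (a + 1) (b + 1) n"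
    using jacobi_h_raise_lower[OF ab, of n] unfolding of_nat_Suc by algebra
  then have "2 / sqrt (jacobi_K a b) * sqrt ?Y * sqrt (jacobi_h a b (Suc n)) =
    (real n + a + b + 2) * sqrt (jacobi_h (a + 1) (b + 1) n)"
    using pos jacobi_K_pos[OF ab] by (intro sqrt_mult_eqI) auto
  \<comment> \<open>The factor \<open>a - b\<close> may be negative, so it is kept outside the use
    of \<open>sqrt_mult_eqI\<close>; it absorbs the minus sign of
    \<open>jacobi_beta\<close>.\<close>
  moreover have "jacobi_beta a b (Suc n) * sqrt (jacobi_h a b (Suc n)) =
    (2 / sqrt (jacobi_K a b) * sqrt ?Y * sqrt (jacobi_h a b (Suc n))) * ((a - b) /
      ((a + b + 2 * real (Suc n)) * (a + b + 2 * real (Suc n) + 2)))"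
  proof -
    have "- k * ((b - a) * s / d) * t = k * s * t * ((a - b) / d)" for k s d t :: real
      by (simp add: algebra_simps diff_divide_distrib)
    then show ?thesis unfolding jacobi_beta_def .
  qed
  moreover have "a + b + 2 * real (Suc n) = 2 * real n + a + b + 2" by simp
  ultimately show ?thesis
    by (simp only:) (simp add: add_ac mult_ac)
qed

lemma jacobi_gamma_altdef:
  assumes ab: "a > -1" "b > -1"
  shows "jacobi_gamma a b (Suc (Suc n)) * sqrt (jacobi_h a b (Suc (Suc n))) =
    - ((real n + 2 + a) * (real n + 2 + b) / ((2 * real n + a + b + 4) * (2 * real n + a + b + 5)) * sqrt (jacobi_h (a + 1) (b + 1) n))"
proof -
  let ?m = "real (Suc (Suc n))"
  let ?Z = "?m * (?m - 1) * (a + ?m) * (b + ?m) / ((a + b + 2 * ?m - 1) * (a + b + 2 * ?m + 1))"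
  let ?c = "(real n + 2 + a) * (real n + 2 + b) / (2 * real n + a + b + 5)"
  have pos: "2 * real n + a + b + 3 > 0" "2 * real n + a + b + 5 > 0" "real n + 2 + a > 0" "real n + 2 + b > 0"
    using ab by linarith+
  have m: "?m = real n + 2" "?m - 1 = real n + 1" "a + b + 2 * ?m - 1 = 2 * real n + a + b + 3"
    "a + b + 2 * ?m + 1 = 2 * real n + a + b + 5" "2 * ?m + a + b = 2 * real n + a + b + 4"
    by simp_all
  have Z: "?Z = (real n + 2) * (real n + 1) * (real n + 2 + a) * (real n + 2 + b) / ((2 * real n + a + b + 3) * (2 * real n + a + b + 5))"
    unfolding m by (simp add: add_ac)
  have "(2 * real n + a + b + 3) * (2 * real n + a + b + 5) * ?Z = (real n + 2) * (real n + 1) * (real n + 2 + a) * (real n + 2 + b)"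
    unfolding Z using pos by simp
  moreover have "(2 * real n + a + b + 5) * ?c = (real n + 2 + a) * (real n + 2 + b)"
    using pos by simp
  \<comment> \<open>The multiplier clears the denominators of \<open>?Z\<close> and of the square of
    \<open>?c\<close>, which makes the identity polynomial; it is cancelled afterwards.\<close>
  ultimately have "(2 * real n + a + b + 3) * (2 * real n + a + b + 5)\<^sup>2 * (4 * ?Z * jacobi_h a b (Suc (Suc n))) =
    (2 * real n + a + b + 3) * (2 * real n + a + b + 5)\<^sup>2 * (jacobi_K a b * ?c\<^sup>2 * jacobi_h (a + 1) (b + 1) n)"
    using jacobi_h_raise_lower2[OF ab, of n] by algebra
  then have "4 * ?Z * jacobi_h a b (Suc (Suc n)) = jacobi_K a b * ?c\<^sup>2 * jacobi_h (a + 1) (b + 1) n"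
    using pos by (subst (asm) mult_left_cancel) auto
  then have *: "2 / sqrt (jacobi_K a b) * sqrt ?Z * sqrt (jacobi_h a b (Suc (Suc n))) =
    ?c * sqrt (jacobi_h (a + 1) (b + 1) n)"
    using pos jacobi_K_pos[OF ab] by (intro sqrt_mult_eqI) auto
  have "jacobi_gamma a b (Suc (Suc n)) * sqrt (jacobi_h a b (Suc (Suc n))) =
    - ((2 / sqrt (jacobi_K a b) * sqrt ?Z * sqrt (jacobi_h a b (Suc (Suc n)))) / (2 * ?m + a + b))"
  proof -
    have "- k * (1 / d) * z * t = - (k * z * t / d)" for k d z t :: real
      by simp
    then show ?thesis unfolding jacobi_gamma_def .
  qed
  then show ?thesis unfolding * unfolding m(5) by (simp add: mult_ac)
qed

section \<open>Connection with \<open>(a + 1, b + 1)\<close> and its adjoint\<close>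

text \<open>First \<open>a\<close> is raised, then \<open>b\<close>. Each step has two terms, and
  two of the four products meet at degree \<open>n - 1\<close>.\<close>

lemma jacobi_poly_connect:
  assumes ab: "a > -1" "b > -1"
  shows "jacobi_poly a b n =
    smult (jacobi_quot a b n * (real n + a + b + 2) / (2 * real n + a + b + 2)) (jacobi_poly (a + 1) (b + 1) n)
    + (if n = 0 then 0 else smult ((a - b) * (real n + a + b + 1) / ((2 * real n + a + b) * (2 * real n + a + b + 2)))
         (jacobi_poly (a + 1) (b + 1) (n - 1)))
    - (if n \<le> 1 then 0 else smult ((real n + a) * (real n + b) / ((2 * real n + a + b) * (2 * real n + a + b + 1)))
         (jacobi_poly (a + 1) (b + 1) (n - 2)))"
proof (cases "n = 0")
  case True
  then show ?thesis using ab by (simp add: jacobi_poly_0 jacobi_quot_def)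
next
  case False
  let ?R = "jacobi_poly (a + 1) b" and ?Q = "jacobi_poly (a + 1) (b + 1)"
  have "real n \<ge> 1" using False by simp
  then have pos: "2 * real n + a + b > 0" "2 * real n + a + b + 1 > 0" "2 * real n + a + b + 2 > 0"
    using ab by linarith+
  have R: "?R n = smult ((real n + a + b + 2) / (2 * real n + a + b + 2)) (?Q n)
      + smult ((real n + a + 1) / (2 * real n + a + b + 2)) (?Q (n - 1))"
  proof -
    have "smult (2 * real n + a + b + 2) (?R n) = smult (2 * real n + a + b + 2)
      (smult ((real n + a + b + 2) / (2 * real n + a + b + 2)) (?Q n)
      + smult ((real n + a + 1) / (2 * real n + a + b + 2)) (?Q (n - 1)))"
      using jacobi_poly_connect_b[of n "a + 1" b] False pos
      by (simp add: smult_add_right add_ac)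
    then show ?thesis using pos by (metis smult_cancel order_less_irrefl)
  qed
  have R': "?R (n - 1) = smult ((real n + a + b + 1) / (2 * real n + a + b)) (?Q (n - 1))
      + (if n \<le> 1 then 0 else smult ((real n + a) / (2 * real n + a + b)) (?Q (n - 2)))"
  proof -
    have eqs: "n - 1 - 1 = n - 2" "n - 1 = 0 \<longleftrightarrow> n \<le> 1"
      "2 * real (n - 1) + (a + 1) + b + 1 = 2 * real n + a + b"
      "real (n - 1) + (a + 1) + b + 1 = real n + a + b + 1" "real (n - 1) + (a + 1) = real n + a"
      using False by (auto simp: of_nat_diff)
    have "smult (2 * real n + a + b) (?R (n - 1)) = smult (2 * real n + a + b)
      (smult ((real n + a + b + 1) / (2 * real n + a + b)) (?Q (n - 1))
      + (if n \<le> 1 then 0 else smult ((real n + a) / (2 * real n + a + b)) (?Q (n - 2))))"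
      using jacobi_poly_connect_b[of "n - 1" "a + 1" b] pos
      unfolding eqs by (simp add: smult_add_right)
    then show ?thesis using pos by (metis smult_cancel order_less_irrefl)
  qed
  have q: "jacobi_quot a b n = (real n + a + b + 1) / (2 * real n + a + b + 1)"
    using False by (simp add: jacobi_quot_def)
  \<comment> \<open>The numerator \<open>(n + a + 1) * (2 * n + a + b) - (n + b) * (2 * n + a + b +
    2)\<close> factors as \<open>(a - b) * (2 * n + a + b + 1)\<close>, and the last factor
    cancels.\<close>
  have coeff: "jacobi_quot a b n * ((real n + a + 1) / (2 * real n + a + b + 2))
      - (real n + b) / (2 * real n + a + b + 1) * ((real n + a + b + 1) / (2 * real n + a + b)) =
      (a - b) * (real n + a + b + 1) / ((2 * real n + a + b) * (2 * real n + a + b + 2))"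
    unfolding q using pos by (simp add: divide_simps) algebra
  have "jacobi_poly a b n = smult (jacobi_quot a b n) (?R n)
      - smult ((real n + b) / (2 * real n + a + b + 1)) (?R (n - 1))"
    using jacobi_poly_connect_a'[OF ab, of n] False by simp
  also have "\<dots> = smult (jacobi_quot a b n * ((real n + a + b + 2) / (2 * real n + a + b + 2))) (?Q n)
     + smult (jacobi_quot a b n * ((real n + a + 1) / (2 * real n + a + b + 2))
      - (real n + b) / (2 * real n + a + b + 1) * ((real n + a + b + 1) / (2 * real n + a + b))) (?Q (n - 1))
     - (if n \<le> 1 then 0 else
       smult ((real n + b) / (2 * real n + a + b + 1) * ((real n + a) / (2 * real n + a + b))) (?Q (n - 2)))"
    unfolding R R' by (simp add: smult_add_right smult_diff_left)
  finally show ?thesis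
    unfolding coeff using False by (simp add: mult_ac)
qed

text \<open>The factor \<open>y\<close> lowers the first parameter, producing degrees
  \<open>n\<close> and \<open>n + 1\<close>; then \<open>1 - y\<close> lowers the second one for
  each of them.\<close>

lemma jacobi_poly_times_y_1_minus_y:
  assumes ab: "a > -1" "b > -1"
  shows "(2 * real n + a + b + 3) * (y * (1 - y) * poly (jacobi_poly (a + 1) (b + 1) n) y) =
    (real n + a + 1) * (real n + b + 1) / (2 * real n + a + b + 2) * poly (jacobi_poly a b n) y
    + (a - b) * (real n + 1) * (2 * real n + a + b + 3) / ((2 * real n + a + b + 2) * (2 * real n + a + b + 4)) * poly (jacobi_poly a b (Suc n)) y
    - (real n + 1) * (real n + 2) / (2 * real n + a + b + 4) * poly (jacobi_poly a b (Suc (Suc n))) y"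
proof -
  have pos: "2 * real n + a + b + 2 > 0" "2 * real n + a + b + 4 > 0" using ab by linarith+
  have 1: "(2 * real n + a + b + 3) * (y * poly (jacobi_poly (a + 1) (b + 1) n) y) =
    (real n + a + 1) * poly (jacobi_poly a (b + 1) n) y - (real n + 1) * poly (jacobi_poly a (b + 1) (Suc n)) y"
    using arg_cong[OF jacobi_poly_times_y[OF ab(1), of n "b + 1"], of "\<lambda>p. poly p y"]
    by (simp add: add_ac mult_ac)
  have 2: "(1 - y) * poly (jacobi_poly a (b + 1) n) y =
    ((real n + b + 1) * poly (jacobi_poly a b n) y + (real n + 1) * poly (jacobi_poly a b (Suc n)) y) / (2 * real n + a + b + 2)" for n
  proof -
    have "2 * real n + a + b + 2 > 0" using ab by linarith
    moreover have "((1 - y) * poly (jacobi_poly a (b + 1) n) y) * (2 * real n + a + b + 2) =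
      (real n + b + 1) * poly (jacobi_poly a b n) y + (real n + 1) * poly (jacobi_poly a b (Suc n)) y"
      using arg_cong[OF jacobi_poly_times_1_minus_y[OF ab(1), of n b], of "\<lambda>p. poly p y"]
      by (simp add: algebra_simps)
    ultimately show ?thesis by (simp add: eq_divide_eq)
  qed
  have 3: "2 * real (Suc n) + a + b + 2 = 2 * real n + a + b + 4" by simp
  have "(2 * real n + a + b + 3) * (y * (1 - y) * poly (jacobi_poly (a + 1) (b + 1) n) y) =
    (real n + a + 1) * ((1 - y) * poly (jacobi_poly a (b + 1) n) y)
    - (real n + 1) * ((1 - y) * poly (jacobi_poly a (b + 1) (Suc n)) y)"
    using 1 by algebra
  also have "\<dots> = (real n + a + 1) * (real n + b + 1) / (2 * real n + a + b + 2) * poly (jacobi_poly a b n) y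
    + (a - b) * (real n + 1) * (2 * real n + a + b + 3) / ((2 * real n + a + b + 2) * (2 * real n + a + b + 4)) * poly (jacobi_poly a b (Suc n)) y
    - (real n + 1) * (real n + 2) / (2 * real n + a + b + 4) * poly (jacobi_poly a b (Suc (Suc n))) y"
    unfolding 2 3 of_nat_Suc using pos by (simp add: divide_simps) algebra
  finally show ?thesis .
qed


lemma jacobi_D_smult: "jacobi_D a b (smult c p) = smult c (jacobi_D a b p)"
  by (simp only: jacobi_D_def pderiv_smult mult_smult_right smult_add_right)

text \<open>The function \<open>jacobi_phi\<close> as a real polynomial in \<open>y\<close>, so that
  derivatives are formal. At \<open>(a + 1, b + 1)\<close> these are the
  \<open>\<Phi>\<^sub>n\<close>.\<close>

definition jacobi_p :: "real \<Rightarrow> real \<Rightarrow> nat \<Rightarrow> real poly" where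
  "jacobi_p a b n = smult (1 / sqrt (jacobi_h a b n)) (jacobi_poly a b n)"

lemma jacobi_beta_gamma_small [simp]:
  "jacobi_beta a b 0 = 0" "jacobi_gamma a b 0 = 0" "jacobi_gamma a b (Suc 0) = 0"
  by (simp_all add: jacobi_beta_def jacobi_gamma_def)

text \<open>
  For \<open>n \<le> 1\<close> the truncated indices \<open>n - 1\<close> and \<open>n - 2\<close> do no harm, since \<open>\<beta>\<^sub>0 = \<gamma>\<^sub>0 = \<gamma>\<^sub>1 = 0\<close>.
\<close>
lemma jacobi_p_connect:
  assumes ab: "a > -1" "b > -1"
  shows "jacobi_p a b n = smult (jacobi_alpha a b n) (jacobi_p (a + 1) (b + 1) n)
    + smult (jacobi_beta a b n) (jacobi_p (a + 1) (b + 1) (n - 1))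
    + smult (jacobi_gamma a b n) (jacobi_p (a + 1) (b + 1) (n - 2))"
proof -
  let ?h = "\<lambda>n. sqrt (jacobi_h a b n)" and ?g = "\<lambda>n. sqrt (jacobi_h (a + 1) (b + 1) n)"
  have pos: "?h n > 0" "?g n > 0" for n
    using jacobi_h_pos[OF ab, of n] jacobi_h_pos[of "a + 1" "b + 1" n] ab by auto
  have al: "1 / ?h n * (jacobi_quot a b n * (real n + a + b + 2) / (2 * real n + a + b + 2))
      = jacobi_alpha a b n * (1 / ?g n)"
  proof -
    have "1 / u * q = t * (1 / v)" if "t * u = q * v" "u > 0" "v > 0" for t u q v :: real
      using that by (simp add: field_simps)
    then show ?thesis using jacobi_alpha_altdef[OF ab] pos by blast
  qed
  have be: "1 / ?h n * ((a - b) * (real n + a + b + 1) / ((2 * real n + a + b) * (2 * real n + a + b + 2)))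
      = jacobi_beta a b n * (1 / ?g (n - 1))" if n: "n > 0"
  proof -
    obtain m where m: "n = Suc m" using n by (cases n) auto
    have r: "real n + a + b + 1 = real m + a + b + 2" "2 * real n + a + b = 2 * real m + a + b + 2"
      "2 * real n + a + b + 2 = 2 * real m + a + b + 4" by (simp_all add: m)
    have "jacobi_beta a b n = (a - b) * (real m + a + b + 2) /
        ((2 * real m + a + b + 2) * (2 * real m + a + b + 4)) * ?g m / ?h n"
      using jacobi_beta_altdef[OF ab, of m] pos[of n] unfolding m by (simp only: eq_divide_eq) simp
    then show ?thesis unfolding r using pos[of m] by (simp add: m)
  qed
  have ga: "1 / ?h n * ((real n + a) * (real n + b) / ((2 * real n + a + b) * (2 * real n + a + b + 1)))
      = - jacobi_gamma a b n * (1 / ?g (n - 2))" if n: "n > 1"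
  proof -
    obtain m where m: "n = Suc (Suc m)" using n by (cases n; cases "n - 1") auto
    have r: "real n + a = real m + 2 + a" "real n + b = real m + 2 + b" "2 * real n + a + b = 2 * real m + a + b + 4"
      "2 * real n + a + b + 1 = 2 * real m + a + b + 5" by (simp_all add: m)
    have "jacobi_gamma a b n = - ((real m + 2 + a) * (real m + 2 + b) /
        ((2 * real m + a + b + 4) * (2 * real m + a + b + 5)) * ?g m) / ?h n"
      using jacobi_gamma_altdef[OF ab, of m] pos[of n] unfolding m by (simp only: eq_divide_eq) simp
    then show ?thesis unfolding r using pos[of m] by (simp add: m)
  qed
  have "jacobi_p a b n = smult (1 / ?h n * (jacobi_quot a b n * (real n + a + b + 2) / (2 * real n + a + b + 2)))
      (jacobi_poly (a + 1) (b + 1) n)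
    + (if n = 0 then 0 else smult (1 / ?h n * ((a - b) * (real n + a + b + 1) / ((2 * real n + a + b) * (2 * real n + a + b + 2))))
         (jacobi_poly (a + 1) (b + 1) (n - 1)))
    - (if n \<le> 1 then 0 else smult (1 / ?h n * ((real n + a) * (real n + b) / ((2 * real n + a + b) * (2 * real n + a + b + 1))))
         (jacobi_poly (a + 1) (b + 1) (n - 2)))"
    unfolding jacobi_p_def using jacobi_poly_connect[OF ab, of n]
    by (simp only: smult_add_right smult_diff_right smult_smult if_distrib[of "smult _"] smult_0_right)
  also have "\<dots> = smult (jacobi_alpha a b n) (jacobi_p (a + 1) (b + 1) n)
    + (if n = 0 then 0 else smult (jacobi_beta a b n) (jacobi_p (a + 1) (b + 1) (n - 1)))
    + (if n \<le> 1 then 0 else smult (jacobi_gamma a b n) (jacobi_p (a + 1) (b + 1) (n - 2)))"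
    unfolding al using be ga by (simp add: jacobi_p_def)
  also have "\<dots> = smult (jacobi_alpha a b n) (jacobi_p (a + 1) (b + 1) n)
    + smult (jacobi_beta a b n) (jacobi_p (a + 1) (b + 1) (n - 1))
    + smult (jacobi_gamma a b n) (jacobi_p (a + 1) (b + 1) (n - 2))"
    by (cases n; cases "n - 1") auto
  finally show ?thesis .
qed

text \<open>Since \<open>1 - x^2\<close> times one weight is \<open>jacobi_K\<close> times the
  other, multiplication by \<open>1 - x^2\<close> is \<open>jacobi_K\<close> times the adjoint of
  the change of basis in \<open>jacobi_p_connect\<close>. This explains the transposed coefficients;
  the proof verifies them explicitly.\<close>

lemma jacobi_p_times_y_1_minus_y:
  assumes ab: "a > -1" "b > -1"
  shows "4 * y * (1 - y) * poly (jacobi_p (a + 1) (b + 1) n) y = jacobi_K a b *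
    (jacobi_alpha a b n * poly (jacobi_p a b n) y
     + jacobi_beta a b (Suc n) * poly (jacobi_p a b (Suc n)) y
     + jacobi_gamma a b (Suc (Suc n)) * poly (jacobi_p a b (Suc (Suc n))) y)"
proof -
  let ?h = "\<lambda>n. sqrt (jacobi_h a b n)" and ?g = "sqrt (jacobi_h (a + 1) (b + 1) n)"
  let ?P = "\<lambda>n. poly (jacobi_poly a b n) y" and ?K = "jacobi_K a b"
  have g: "?g > 0" "?g * ?g = jacobi_h (a + 1) (b + 1) n"
    using jacobi_h_pos[of "a + 1" "b + 1" n] ab by auto
  have h: "?h n > 0" "?h n * ?h n = jacobi_h a b n" for n
    using jacobi_h_pos[OF ab, of n] by auto
  have D: "2 * real n + a + b + 2 > 0" "2 * real n + a + b + 3 > 0" "2 * real n + a + b + 4 > 0"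
    "2 * real n + a + b + 5 > 0" using ab by linarith+
  \<comment> \<open>Here \<open>t\<close> is a value of \<open>jacobi_alpha\<close>,
    \<open>jacobi_beta\<close> or \<open>jacobi_gamma\<close>, \<open>C\<close> its rational factor,
    and \<open>c\<close> the matching coefficient in \<open>jacobi_poly_times_y_1_minus_y\<close>.
    Only a norm quotient then has to be checked.\<close>
  have coeff: "4 * c / ((2 * real n + a + b + 3) * ?g) = ?K * (t / ?h m)"
    if t: "t * ?h m = C * ?g"
      and C: "?K * C * jacobi_h (a + 1) (b + 1) n * (2 * real n + a + b + 3) = 4 * c * jacobi_h a b m"
    for m t c C
  proof -
    have "?h m * (4 * c * ?h m) = ?h m * (?K * t * ((2 * real n + a + b + 3) * ?g))"
      using t C g(2) h(2)[of m] by algebra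
    then have "4 * c * ?h m = ?K * t * ((2 * real n + a + b + 3) * ?g)"
      using h(1)[of m] by simp
    then show ?thesis using g(1) h(1)[of m] D by (simp add: divide_simps)
  qed
  have al: "4 * ((real n + a + 1) * (real n + b + 1) / (2 * real n + a + b + 2)) /
      ((2 * real n + a + b + 3) * ?g) = ?K * (jacobi_alpha a b n / ?h n)"
    by (rule coeff[OF jacobi_alpha_altdef[OF ab]])
      (use jacobi_h_raise[OF ab, of n] D in \<open>simp add: divide_simps mult_ac add_ac\<close>)
  have be: "4 * ((a - b) * (real n + 1) * (2 * real n + a + b + 3) /
      ((2 * real n + a + b + 2) * (2 * real n + a + b + 4))) /
      ((2 * real n + a + b + 3) * ?g) = ?K * (jacobi_beta a b (Suc n) / ?h (Suc n))"
  proof (rule coeff[OF jacobi_beta_altdef[OF ab]])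
    have "k * (u * m / v) * e * d = 4 * (u * r * d / v) * f" if "k * m * e = 4 * r * f"
      for k u m v e d r f :: real
    proof -
      have "k * (u * m / v) * e * d = (u * d / v) * (k * m * e)" by simp
      then show ?thesis unfolding that by (simp add: mult_ac)
    qed
    from this[OF jacobi_h_raise_lower[OF ab, of n]] show
      "?K * ((a - b) * (real n + a + b + 2) / ((2 * real n + a + b + 2) * (2 * real n + a + b + 4)))
        * jacobi_h (a + 1) (b + 1) n * (2 * real n + a + b + 3) =
      4 * ((a - b) * (real n + 1) * (2 * real n + a + b + 3) /
        ((2 * real n + a + b + 2) * (2 * real n + a + b + 4))) * jacobi_h a b (Suc n)" .
  qed
  have ga: "4 * (- ((real n + 1) * (real n + 2) / (2 * real n + a + b + 4))) /
      ((2 * real n + a + b + 3) * ?g) = ?K * (jacobi_gamma a b (Suc (Suc n)) / ?h (Suc (Suc n)))"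
    by (rule coeff[OF jacobi_gamma_altdef[OF ab, unfolded minus_mult_left]])
      (use jacobi_h_raise_lower2[OF ab, of n] D in
        \<open>simp add: divide_simps mult_ac add_ac, simp add: algebra_simps\<close>)
  have "4 * y * (1 - y) * poly (jacobi_p (a + 1) (b + 1) n) y =
    4 / ((2 * real n + a + b + 3) * ?g) *
      ((2 * real n + a + b + 3) * (y * (1 - y) * poly (jacobi_poly (a + 1) (b + 1) n) y))"
    using D g(1) by (simp add: jacobi_p_def)
  also have "\<dots> = 4 * ((real n + a + 1) * (real n + b + 1) / (2 * real n + a + b + 2)) /
      ((2 * real n + a + b + 3) * ?g) * ?P n
    + 4 * ((a - b) * (real n + 1) * (2 * real n + a + b + 3) /
      ((2 * real n + a + b + 2) * (2 * real n + a + b + 4))) /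
      ((2 * real n + a + b + 3) * ?g) * ?P (Suc n)
    + 4 * (- ((real n + 1) * (real n + 2) / (2 * real n + a + b + 4))) /
      ((2 * real n + a + b + 3) * ?g) * ?P (Suc (Suc n))"
  proof -
    have "4 / d * (p * P + q * Q - r * R) = 4 * p / d * P + 4 * q / d * Q + 4 * (- r) / d * R"
      for d p q r P Q R :: real
      by (simp add: algebra_simps)
    then show ?thesis unfolding jacobi_poly_times_y_1_minus_y[OF ab] .
  qed
  also have "\<dots> = ?K * (jacobi_alpha a b n * poly (jacobi_p a b n) y
     + jacobi_beta a b (Suc n) * poly (jacobi_p a b (Suc n)) y
     + jacobi_gamma a b (Suc (Suc n)) * poly (jacobi_p a b (Suc (Suc n))) y)"
    unfolding al be ga by (simp add: jacobi_p_def algebra_simps)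
  finally show ?thesis .
qed

lemma jacobi_D_jacobi_p:
  assumes "a > -1"
  shows "jacobi_D (a + 1) (b + 1) (jacobi_p (a + 1) (b + 1) n) =
    smult (jacobi_Lambda a b (int n)) (jacobi_p (a + 1) (b + 1) n)"
proof -
  have "jacobi_D (a + 1) (b + 1) (jacobi_p (a + 1) (b + 1) n) =
    smult (1 / sqrt (jacobi_h (a + 1) (b + 1) n))
      (jacobi_D (a + 1) (b + 1) (jacobi_poly (a + 1) (b + 1) n))"
    unfolding jacobi_p_def jacobi_D_smult ..
  also have "jacobi_D (a + 1) (b + 1) (jacobi_poly (a + 1) (b + 1) n) =
    smult (jacobi_Lambda a b (int n)) (jacobi_poly (a + 1) (b + 1) n)"
    unfolding jacobi_D_def using jacobi_poly_ode[of "a + 1" "b + 1" n] assms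
    by (simp add: jacobi_Lambda_def add_ac)
  finally show ?thesis by (simp add: jacobi_p_def mult_ac)
qed


section \<open>The operator \<open>T\<close> on polynomials and on the basis\<close>

text \<open>The chain rule gives \<open>d/dx = - 1/2 d/dy\<close>, and the first-order coefficient
  of \<open>T\<close> is \<open>1 - x^2\<close> times that of the Jacobi operator for
  \<open>(a + 1, b + 1)\<close>.\<close>

lemma jacobi_T_poly:
  "jacobi_T a b \<kappa> (\<lambda>x. of_real (poly p ((1 - x) / 2))) x = of_real (1 - x\<^sup>2) *
    (of_real (poly (jacobi_D (a + 1) (b + 1) p) ((1 - x) / 2))
     + jacobi_rho a b \<kappa> * of_real (poly p ((1 - x) / 2)))"
proof -
  \<comment> \<open>The constant \<open>c\<close> makes the form stable under differentiation, so
    the same fact yields the second derivative.\<close>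
  have deriv: "vector_derivative (\<lambda>x. complex_of_real (c * poly q ((1 - x) / 2))) (at x) =
      of_real (- c / 2 * poly (pderiv q) ((1 - x) / 2))" for c q x
  proof -
    have "((\<lambda>x. c * poly q ((1 - x) / 2)) has_real_derivative - c / 2 * poly (pderiv q) ((1 - x) / 2)) (at x)"
      by (auto intro!: derivative_eq_intros)
    then show ?thesis
      by (intro vector_derivative_at has_vector_derivative_of_real)
        (simp add: has_real_derivative_iff_has_vector_derivative)
  qed
  let ?y = "(1 - x) / 2"
  have d1: "vector_derivative (\<lambda>x. complex_of_real (poly p ((1 - x) / 2))) (at x) =
      of_real (- 1 / 2 * poly (pderiv p) ((1 - x) / 2))" for x
    using deriv[of 1 p x] by simp
  have d2: "vector_derivative (\<lambda>x. complex_of_real (- 1 / 2 * poly (pderiv p) ((1 - x) / 2))) (at x) =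
      of_real (1 / 4 * poly (pderiv (pderiv p)) ((1 - x) / 2))"
    using deriv[of "- 1 / 2" "pderiv p" x] by simp
  have D: "(1 - x\<^sup>2)\<^sup>2 * (1 / 4 * poly (pderiv (pderiv p)) ?y)
      + (1 - x\<^sup>2) * (b - a - (a + b + 4) * x) * (- 1 / 2 * poly (pderiv p) ?y)
      = (1 - x\<^sup>2) * poly (jacobi_D (a + 1) (b + 1) p) ?y"
    by (simp add: jacobi_D_def field_simps power2_eq_square)
  have "jacobi_T a b \<kappa> (\<lambda>x. of_real (poly p ((1 - x) / 2))) x =
    of_real ((1 - x\<^sup>2)\<^sup>2 * (1 / 4 * poly (pderiv (pderiv p)) ?y)
      + (1 - x\<^sup>2) * (b - a - (a + b + 4) * x) * (- 1 / 2 * poly (pderiv p) ?y))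
    + 1 / 4 * (\<kappa>\<^sup>2 - (of_real (a + b + 3))\<^sup>2) * of_real (1 - x\<^sup>2) * of_real (poly p ?y)"
    unfolding jacobi_T_def d1 d2 by (simp only: of_real_mult of_real_add)
  moreover have "u * d + 1 / 4 * r * u * v = u * (d + r / 4 * v)" for u d r v :: complex
    by (simp add: algebra_simps)
  ultimately show ?thesis
    unfolding D jacobi_rho_def of_real_mult by simp
qed

text \<open>The expansion into \<open>\<Phi>\<close> and the return use the same coefficients with
  indices transposed, so the matrix of \<open>T\<close> is symmetric. Hence \<open>coeff_b\<close>
  and \<open>coeff_a\<close> recur, shifted, below the diagonal.\<close>

lemma jacobi_T_phi:
  assumes ab: "a > -1" "b > -1"
  shows "jacobi_T a b \<kappa> (jacobi_phi a b n) x =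
         coeff_a a b \<kappa> n * jacobi_phi a b (n + 2) x
         + coeff_b a b \<kappa> n * jacobi_phi a b (n + 1) x
         + coeff_c a b \<kappa> n * jacobi_phi a b n x
         + (if n \<ge> 1 then coeff_b a b \<kappa> (n - 1) * jacobi_phi a b (n - 1) x else 0)
         + (if n \<ge> 2 then coeff_a a b \<kappa> (n - 2) * jacobi_phi a b (n - 2) x else 0)"
proof -
  let ?y = "(1 - x) / 2" and ?\<rho> = "jacobi_rho a b \<kappa>"
  let ?\<Lambda> = "\<lambda>n. complex_of_real (jacobi_Lambda a b n)"
  let ?Q = "\<lambda>n. poly (jacobi_p (a + 1) (b + 1) n) ?y"
  let ?al = "jacobi_alpha a b" and ?be = "jacobi_beta a b" and ?ga = "jacobi_gamma a b"
  have phi: "jacobi_phi a b n = (\<lambda>x. of_real (poly (jacobi_p a b n) ((1 - x) / 2)))" for n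
    by (simp add: fun_eq_iff jacobi_phi_def jacobi_p_def poly_jacobi_poly)
  define E where "E m = of_real (1 - x\<^sup>2) * complex_of_real (?Q m)" for m
  have E: "E m = of_real (jacobi_K a b) * (of_real (?al m) * jacobi_phi a b m x
     + of_real (?be (Suc m)) * jacobi_phi a b (Suc m) x
     + of_real (?ga (Suc (Suc m))) * jacobi_phi a b (Suc (Suc m)) x)" for m
  proof -
    have "1 - x\<^sup>2 = 4 * ?y * (1 - ?y)"
      by (simp add: field_simps power2_eq_square)
    then have "E m = of_real (4 * ?y * (1 - ?y) * ?Q m)"
      by (simp only: E_def of_real_mult)
    then show ?thesis
      unfolding jacobi_p_times_y_1_minus_y[OF ab] phi by (simp only: of_real_mult of_real_add)
  qed
  have D: "jacobi_D (a + 1) (b + 1) (jacobi_p a b n) =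
     smult (?al n * jacobi_Lambda a b (int n)) (jacobi_p (a + 1) (b + 1) n)
     + smult (?be n * jacobi_Lambda a b (int (n - 1))) (jacobi_p (a + 1) (b + 1) (n - 1))
     + smult (?ga n * jacobi_Lambda a b (int (n - 2))) (jacobi_p (a + 1) (b + 1) (n - 2))"
    by (subst jacobi_p_connect[OF ab])
      (simp only: jacobi_D_add jacobi_D_smult jacobi_D_jacobi_p[OF ab(1)] smult_smult)
  have "jacobi_T a b \<kappa> (jacobi_phi a b n) x = of_real (1 - x\<^sup>2) *
    (of_real (poly (jacobi_D (a + 1) (b + 1) (jacobi_p a b n)) ?y)
     + ?\<rho> * of_real (poly (jacobi_p a b n) ?y))"
    unfolding phi by (rule jacobi_T_poly)
  also have "poly (jacobi_p a b n) ?y = ?al n * ?Q n + ?be n * ?Q (n - 1) + ?ga n * ?Q (n - 2)"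
    by (subst jacobi_p_connect[OF ab]) simp
  also have "of_real (1 - x\<^sup>2) * (of_real (poly (jacobi_D (a + 1) (b + 1) (jacobi_p a b n)) ?y)
       + ?\<rho> * of_real (?al n * ?Q n + ?be n * ?Q (n - 1) + ?ga n * ?Q (n - 2)))
    = of_real (?al n) * (?\<Lambda> (int n) + ?\<rho>) * E n
      + of_real (?be n) * (?\<Lambda> (int (n - 1)) + ?\<rho>) * E (n - 1)
      + of_real (?ga n) * (?\<Lambda> (int (n - 2)) + ?\<rho>) * E (n - 2)"
    unfolding D E_def by (simp add: algebra_simps)
  finally have T: "jacobi_T a b \<kappa> (jacobi_phi a b n) x =
      of_real (?al n) * (?\<Lambda> (int n) + ?\<rho>) * E n
      + of_real (?be n) * (?\<Lambda> (int (n - 1)) + ?\<rho>) * E (n - 1)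
      + of_real (?ga n) * (?\<Lambda> (int (n - 2)) + ?\<rho>) * E (n - 2)" .
  \<comment> \<open>Below 2, truncated indices such as \<open>int (n - 2)\<close> differ from
    \<open>int n - 2\<close> in the coefficients; the affected terms carry
    \<open>jacobi_beta\<close> or \<open>jacobi_gamma\<close> values that are zero.\<close>
  consider "n = 0" | "n = 1" | m where "n = Suc (Suc m)"
    by (metis One_nat_def not0_implies_Suc)
  then show ?thesis
  proof cases
    case 1
    then show ?thesis unfolding T E
      by (simp add: coeff_a_def coeff_b_def coeff_c_def power2_eq_square algebra_simps numeral_2_eq_2)
  next
    case 2
    then show ?thesis unfolding T E
      by (simp add: coeff_a_def coeff_b_def coeff_c_def power2_eq_square algebra_simps numeral_2_eq_2)
  next
    case 3
    have "int n - 1 = int (Suc m)" "int n - 2 = int m" "n - 1 = Suc m" "n - 2 = m" using 3 by auto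
    then show ?thesis unfolding T E
      by (simp add: coeff_a_def coeff_b_def coeff_c_def power2_eq_square algebra_simps 3)
  qed
qed

theorem proposition3p2:
  fixes \<alpha> \<beta> :: real and \<kappa> :: complex
  assumes "\<alpha> > -1" and "\<beta> > -1" and "\<beta> \<ge> \<alpha>"
    and "(\<exists>r\<ge>0. \<kappa> = complex_of_real r) \<or> (\<exists>r>0. \<kappa> = \<i> * complex_of_real r)"
  shows "L2_orthonormal_basis (jacobi_measure \<alpha> \<beta>) (jacobi_phi \<alpha> \<beta>) \<and>
    (\<forall>n. \<forall>x\<in>{-1<..<1}.
       jacobi_T \<alpha> \<beta> \<kappa> (jacobi_phi \<alpha> \<beta> n) x =
         coeff_a \<alpha> \<beta> \<kappa> n * jacobi_phi \<alpha> \<beta> (n + 2) x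
         + coeff_b \<alpha> \<beta> \<kappa> n * jacobi_phi \<alpha> \<beta> (n + 1) x
         + coeff_c \<alpha> \<beta> \<kappa> n * jacobi_phi \<alpha> \<beta> n x
         + (if n \<ge> 1 then coeff_b \<alpha> \<beta> \<kappa> (n - 1) * jacobi_phi \<alpha> \<beta> (n - 1) x else 0)
         + (if n \<ge> 2 then coeff_a \<alpha> \<beta> \<kappa> (n - 2) * jacobi_phi \<alpha> \<beta> (n - 2) x else 0))"
  using jacobi_phi_orthonormal_basis[OF assms(1,2)] jacobi_T_phi[OF assms(1,2)] by blast

end
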